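(* Let $n,m\ge 1$, let $V_1,\ldots,V_{2m}\le\mathbb{R}^n$ be linear subspaces with $V_{j+m}=V_j$ for $1\le j\le m$, and let $p_1,\ldots,p_{2m}\in(0,\infty]$. Suppose there is a finite constant $C$ such that $$\mathcal{M}(f_1,\ldots,f_{2m})\le C\prod_{j=1}^m\|f_j\|_{L^{p_j}(V_j\times\mathbb{R}^n\times\mathbb{R})}\,\|f_{j+m}\|_{L^{p_{j+m}}(\mathbb{R}^n\times V_j\times\mathbb{R})}$$ for all nonnegative, continuous, compactly supported functions $f_1,\ldots,f_{2m}$. Then $p_j\ge1$ for all $1\le j\le 2m$, and for all subspaces $V\le\mathbb{R}^n$ and $W\le V^\perp$ all of the following hold: $$\text{(A)}\quad n+1=\sum_{j=1}^{m}\Big(\frac{\dim V_j+1}{p_j}+\frac{n+1}{p_{j+m}}\Big)=\sum_{j=1}^{m}\Big(\frac{n+1}{p_j}+\frac{\dim V_j+1}{p_{j+m}}\Big);$$ $$\text{(B1)}\quad \dim V+1\le\sum_{j=1}^{m}\Big(\frac{\dim L_jV+1}{p_j}+\frac{\dim V+1}{p_{j+m}}\Big);$$ $$\text{(B2)}\quad \dim V+1\le\sum_{j=1}^{m}\Big(\frac{\dim V+1}{p_j}+\frac{\dim L_jV+1}{p_{j+m}}\Big);$$ $$\text{(C1)}\quad \dim W^\perp-\dim V\ge\sum_{j=1}^m\Big(\frac{\dim W^\perp-\dim L_jV}{p_j}+\frac{\dim(L_jW)^\perp-\dim V}{p_{j+m}}\Big);$$ $$\text{(C2)}\quad \dim W^\perp-\dim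 V\ge\sum_{j=1}^m\Big(\frac{\dim(L_jW)^\perp-\dim V}{p_j}+\frac{\dim W^\perp-\dim L_jV}{p_{j+m}}\Big).$$
   Context: Identify the Heisenberg group $\mathbb{H}^n$ with $\mathbb{R}^n\times\mathbb{R}^n\times\mathbb{R}$, with coordinates $(x,y,t)$ and Lebesgue measure. $V\le W$ means $V$ is a linear subspace of $W$. For $1\le j\le 2m$, $L_j:\mathbb{R}^n\to V_j$ is the orthogonal projection onto $V_j$ (so $L_{j+m}=L_j$), and $\hat L_j=\mathbb{I}_n-L_j$ is the orthogonal projection onto the orthogonal complement of $V_j$. For $1\le j\le m$ define $$\pi_j(x,y,t)=(L_jx,\,y,\,t+\tfrac12\hat L_jx\cdot\hat L_jy)\in V_j\times\mathbb{R}^n\times\mathbb{R},$$ $$\pi_{j+m}(x,y,t)=(x,\,L_jy,\,t-\tfrac12\hat L_jx\cdot\hat L_jy)\in\mathbb{R}^n\times V_j\times\mathbb{R},$$ and $$\mathcal{M}(f_1,\ldots,f_{2m})=\int_{\mathbb{H}^n}\prod_{j=1}^{2m}f_j\circ\pi_j(x,y,t)\,dx\,dy\,dt,$$ where $f_j$ is defined on the codomain of $\pi_j$. For a subspace $U\le\mathbb{R}^n$, $U^\perp$ denotes its orthogonal complement in $\mathbb{R}^n$, whereas $(L_jU)^\perp$ denotes the orthogonal complement of $L_jU$ inside $V_j$. Convention: $1/\infty=0$. All $L^p$ (quasi-)norms are with respect to Lebesgue measure. *)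

theory Defs
  imports "HOL-Analysis.Analysis" "HOL-Probability.Essential_Supremum"
begin

type_synonym 'n heis = "(real ^ 'n) \<times> (real ^ 'n) \<times> real"

definition orth_proj :: "(real ^ 'n) set \<Rightarrow> real ^ 'n \<Rightarrow> real ^ 'n" where
  "orth_proj S x = (THE y. y \<in> S \<and> (\<forall>v\<in>S. orthogonal v (x - y)))"

lemma orth_proj_unique:
  fixes S :: "(real ^ 'n) set"
  assumes "subspace S"
  shows "\<exists>!y. y \<in> S \<and> (\<forall>v\<in>S. orthogonal v (x - y))"
proof -
  obtain y z where yz: "y \<in> span S" "\<And>w. w \<in> span S \<Longrightarrow> orthogonal z w" "x = y + z"
    using orthogonal_subspace_decomp_exists[of S x] by blast
  have sp: "span S = S"
    using assms by (simp add: span_eq_iff)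
  show ?thesis
  proof (rule ex1I[of _ y])
    show "y \<in> S \<and> (\<forall>v\<in>S. orthogonal v (x - y))"
      using yz sp by (simp add: orthogonal_commute)
  next
    fix y' assume a: "y' \<in> S \<and> (\<forall>v\<in>S. orthogonal v (x - y'))"
    have d: "y - y' \<in> S"
      using a yz(1) sp assms by (simp add: subspace_diff)
    have "orthogonal (y - y') (x - y')" "orthogonal (y - y') (x - y)"
      using a yz(2)[of "y - y'"] d yz(3) sp by (simp_all add: orthogonal_commute)
    then have "(y - y') \<bullet> (y - y') = 0"
      by (simp add: orthogonal_def inner_diff_right)
    then show "y' = y" by simp
  qed
qed

definition orthonormal_basis :: "(real ^ 'n) set \<Rightarrow> (real ^ 'n) set \<Rightarrow> bool" where
  "orthonormal_basis S B \<longleftrightarrow> B \<subseteq> S \<and> pairwise orthogonal B \<and> (\<forall>b\<in>B. norm b = 1) \<and> span B = S"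

lemma orthonormal_basis_exists:
  fixes S :: "(real ^ 'n) set"
  assumes "subspace S"
  shows "\<exists>B. orthonormal_basis S B"
  using orthonormal_basis_subspace[OF assms] unfolding orthonormal_basis_def by metis

text \<open>
  Lebesgue measure on a linear subspace S, as a measure whose underlying space is S itself. This is
  the library's construction of \<^const>\<open>lborel\<close> with an orthonormal basis of S in place of
  \<^const>\<open>Basis\<close>; by rotation invariance of Lebesgue measure the result does not depend on which
  orthonormal basis is chosen. For the zero subspace it is the unit point mass at 0.
\<close>
definition lborel_subspace :: "(real ^ 'n) set \<Rightarrow> (real ^ 'n) measure" where
  "lborel_subspace S =
     (let B = (SOME B. orthonormal_basis S B)
      in distr (\<Pi>\<^sub>M b\<in>B. lborel) (restrict_space borel S) (\<lambda>c. \<Sum>b\<in>B. c b *\<^sub>R b))"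

definition Lp_norm :: "ennreal \<Rightarrow> 'a measure \<Rightarrow> ('a \<Rightarrow> real) \<Rightarrow> ennreal" where
  "Lp_norm p M f =
     (if p = \<infinity> then esssup M (\<lambda>z. ennreal \<bar>f z\<bar>)
      else let I = (\<integral>\<^sup>+ z. ennreal (\<bar>f z\<bar> powr enn2real p) \<partial>M)
           in if I = \<infinity> then \<infinity> else ennreal (enn2real I powr (1 / enn2real p)))"

text \<open>
  Throughout, the family of subspaces is \<open>V j\<close> for \<open>1 \<le> j \<le> 2 * m\<close>. The indices \<open>j \<le> m\<close> carry
  the projections onto \<open>V j \<times> \<real>\<^sup>n \<times> \<real>\<close>, the indices \<open>j > m\<close> those onto \<open>\<real>\<^sup>n \<times> V j \<times> \<real>\<close>.
\<close>
definition heis_proj :: "nat \<Rightarrow> (nat \<Rightarrow> (real ^ 'n) set) \<Rightarrow> nat \<Rightarrow> 'n heis \<Rightarrow> 'n heis" where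
  "heis_proj m V j = (\<lambda>(x, y, t).
     let L = orth_proj (V j); L' = (\<lambda>u. u - L u)
     in if j \<le> m then (L x, y, t + 1/2 * (L' x \<bullet> L' y))
        else (x, L y, t - 1/2 * (L' x \<bullet> L' y)))"

definition heis_codomain :: "nat \<Rightarrow> (nat \<Rightarrow> (real ^ 'n) set) \<Rightarrow> nat \<Rightarrow> 'n heis set" where
  "heis_codomain m V j = (if j \<le> m then V j \<times> UNIV \<times> UNIV else UNIV \<times> V j \<times> UNIV)"

definition heis_measure :: "nat \<Rightarrow> (nat \<Rightarrow> (real ^ 'n) set) \<Rightarrow> nat \<Rightarrow> 'n heis measure" where
  "heis_measure m V j =
     (if j \<le> m then lborel_subspace (V j) \<Otimes>\<^sub>M (lborel \<Otimes>\<^sub>M lborel)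
      else lborel \<Otimes>\<^sub>M (lborel_subspace (V j) \<Otimes>\<^sub>M lborel))"

definition heis_form :: "nat \<Rightarrow> (nat \<Rightarrow> (real ^ 'n) set) \<Rightarrow> (nat \<Rightarrow> 'n heis \<Rightarrow> real) \<Rightarrow> ennreal" where
  "heis_form m V f = (\<integral>\<^sup>+ z. ennreal (\<Prod>j=1..2*m. f j (heis_proj m V j z)) \<partial>lborel)"

text \<open>
  A function on a closed set D is represented by a function on the ambient type, of which only the
  values on D matter. As D is closed, the closure of the support may be taken in the ambient space.
\<close>
definition nonneg_Cc_on :: "'a::topological_space set \<Rightarrow> ('a \<Rightarrow> real) \<Rightarrow> bool" where
  "nonneg_Cc_on D f \<longleftrightarrow>
     continuous_on D f \<and> (\<forall>z\<in>D. 0 \<le> f z) \<and> compact (closure (support_on D f))"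

text \<open>The real number \<open>1 / q\<close>, with \<open>1 / \<infinity> = 0\<close>; it is only used for \<open>q > 0\<close>.\<close>
definition recip :: "ennreal \<Rightarrow> real" where
  "recip q = enn2real (1 / q)"

end

theory Submission
  imports Defs
begin

text \<open>
  For \<open>W \<subseteq> U\<^sup>\<bottom>\<close>, \<open>b \<le> a\<close>, \<open>d \<le> c\<close> and \<open>\<tau> = max (a * d) (b * c)\<close>, test the inequality on the set of
  all \<open>(x, y, t)\<close> with \<open>x\<close> of size \<open>a\<close> along \<open>U\<close> and \<open>b\<close> across it, \<open>y\<close> of size \<open>c\<close> along \<open>W\<close> and \<open>d\<close>
  across it, and \<open>\<bar>t\<bar> \<le> \<tau>\<close>. Orthogonality gives \<open>\<bar>x \<bullet> y\<bar> \<le> 3 * \<tau>\<close>, so the images under the two kinds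
  of projections lie in sheared boxes \<open>\<bar>s \<plusminus> x \<bullet> y / 2\<bar> \<le> 3 * \<tau>\<close> over similar sets for \<open>L\<^sub>j U\<close> or \<open>L\<^sub>j W\<close>.
  All volumes are, up to constants, monomials in \<open>a, b, c, d, \<tau>\<close>. With \<open>a = exp (r * \<alpha>)\<close> and so on,
  letting \<open>r\<close> tend to infinity leaves one linear inequality between the exponents. All the claims are
  instances of it: (A) from \<open>\<alpha> = \<beta> = \<plusminus>1\<close>, \<open>\<gamma> = \<delta> = 0\<close> and symmetrically, (B) and, after
  subtraction from (A), (C) from \<open>\<alpha> = \<gamma> = 1\<close>, \<open>\<beta> = \<delta> = 0\<close>, and \<open>p\<^sub>j \<ge> 1\<close> from
  \<open>U = V\<^sub>j\<^sup>\<bottom>\<close>, \<open>W = 0\<close>, \<open>\<alpha> = 0\<close>, \<open>\<beta> = \<gamma> = \<delta> = -1\<close> and symmetrically.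
\<close>

section \<open>Orthonormal coordinates and coverings of balls in a subspace\<close>

lemma orthonormal_basis_facts:
  assumes "orthonormal_basis S B"
  shows "finite B" "card B = dim S" "B \<subseteq> S" "span B = S" "\<And>b. b \<in> B \<Longrightarrow> norm b = 1"
    "pairwise orthogonal B"
proof -
  show *: "B \<subseteq> S" "span B = S" "pairwise orthogonal B" "\<And>b. b \<in> B \<Longrightarrow> norm b = 1"
    using assms by (auto simp: orthonormal_basis_def)
  then have "independent B"
    by (metis norm_zero pairwise_orthogonal_independent zero_neq_one)
  then show "finite B" "card B = dim S"
    using * by (auto simp: independent_imp_finite dim_eq_card)
qed

lemma orthonormal_basis_inner_sum:
  assumes "orthonormal_basis S B" "b \<in> B"
  shows "(\<Sum>e\<in>B. c e *\<^sub>R e) \<bullet> b = c b"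
proof -
  note B = orthonormal_basis_facts[OF assms(1)]
  have "(\<Sum>e\<in>B. c e *\<^sub>R e) \<bullet> b = (\<Sum>e\<in>B. if e = b then c b else 0)"
    unfolding inner_sum_left
  proof (rule sum.cong)
    fix e assume "e \<in> B"
    then show "c e *\<^sub>R e \<bullet> b = (if e = b then c b else 0)"
      using B(5)[OF assms(2)] B(6) assms(2)
      by (auto simp: pairwise_def orthogonal_def norm_eq_1)
  qed simp
  then show ?thesis using B(1) assms(2) by simp
qed

lemma card_fun_bounded:
  assumes "finite B"
  shows "finite (B \<rightarrow>\<^sub>E {-int N..int N})" "card (B \<rightarrow>\<^sub>E {-int N..int N}) = (2 * N + 1) ^ card B"
proof -
  have "card {-int N..int N} = 2 * N + 1" by simp
  then show "card (B \<rightarrow>\<^sub>E {-int N..int N}) = (2 * N + 1) ^ card B"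
    using assms by (simp add: card_PiE del: card_atLeastAtMost_int)
qed (use assms in \<open>simp add: finite_PiE\<close>)

text \<open>The centres form a grid of mesh \<open>b / n\<close> in orthonormal coordinates, where n
  is the ambient dimension. Rounding the coordinates down moves a point by at most
  \<open>b / n\<close> in each of \<open>dim S \<le> n\<close> directions. Since
  \<open>b \<le> a\<close>, the number \<open>2 * N + 1\<close> of grid values per coordinate is at
  most a multiple of \<open>a / b\<close>.\<close>

lemma subspace_covering:
  fixes S :: "(real ^ 'n) set"
  assumes S: "subspace S" and ab: "0 < b" "b \<le> a"
  obtains Z where "finite Z" "Z \<subseteq> S"
    "real (card Z) \<le> (5 * real CARD('n)) ^ dim S * (a / b) ^ dim S"
    "\<And>x. x \<in> S \<Longrightarrow> norm x \<le> a \<Longrightarrow> \<exists>z\<in>Z. norm (x - z) \<le> b"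
proof -
  obtain B where ob: "orthonormal_basis S B"
    using orthonormal_basis_exists[OF S] by blast
  note B = orthonormal_basis_facts[OF ob]
  define n where "n = real CARD('n)"
  have n: "n \<ge> 1" by (simp add: n_def Suc_leI)
  define h where "h = b / n"
  have h: "h > 0" using ab n by (simp add: h_def)
  define N where "N = nat \<lceil>a / h\<rceil>"
  define g where "g = (\<lambda>k::real^'n \<Rightarrow> int. \<Sum>e\<in>B. (of_int (k e) * h) *\<^sub>R e)"
  define K where "K = B \<rightarrow>\<^sub>E {-int N..int N}"
  have ah: "a / h \<ge> 1"
  proof -
    have "h \<le> b" using n ab by (simp add: h_def field_simps)
    then show ?thesis using h ab by (simp add: field_simps)
  qed
  show ?thesis
  proof (rule that[of "g ` K"])
    show "finite (g ` K)"
      using card_fun_bounded(1)[OF B(1), of N] by (simp add: K_def)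
    show "g ` K \<subseteq> S"
      using S B(3) by (auto simp: g_def intro!: subspace_sum subspace_scale)
    have "real (card (g ` K)) \<le> real (card K)"
      using card_fun_bounded(1)[OF B(1), of N] by (simp add: K_def card_image_le)
    also have "\<dots> = (2 * real N + 1) ^ dim S"
      using card_fun_bounded(2)[OF B(1), of N] B(2) by (simp add: K_def add.commute)
    also have "\<dots> \<le> (5 * (a / h)) ^ dim S"
    proof (rule power_mono)
      have "real N \<le> a / h + 1"
        using ah by (simp add: N_def)
      then show "2 * real N + 1 \<le> 5 * (a / h)" using ah by linarith
    qed simp
    also have "\<dots> = (5 * n) ^ dim S * (a / b) ^ dim S"
      by (simp add: h_def power_mult_distrib power_divide)
    finally show "real (card (g ` K)) \<le> (5 * real CARD('n)) ^ dim S * (a / b) ^ dim S"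
      by (simp add: n_def)
  next
    fix x assume x: "x \<in> S" "norm x \<le> a"
    define k where "k = restrict (\<lambda>e. \<lfloor>(x \<bullet> e) / h\<rfloor>) B"
    have le: "\<bar>x \<bullet> e\<bar> \<le> a" if "e \<in> B" for e
      using Cauchy_Schwarz_ineq2[of x e] x(2) B(5)[OF that] by simp
    have "k \<in> K"
      unfolding K_def
    proof (rule PiE_I)
      fix e assume e: "e \<in> B"
      have "\<bar>(x \<bullet> e) / h\<bar> \<le> a / h" using le[OF e] h by (simp add: divide_right_mono)
      moreover have "a / h \<le> real N" by (simp add: N_def) linarith
      ultimately have "- real_of_int (int N) \<le> (x \<bullet> e) / h" "(x \<bullet> e) / h \<le> real_of_int (int N)"
        by linarith+
      then have "- int N \<le> \<lfloor>(x \<bullet> e) / h\<rfloor>" "\<lfloor>(x \<bullet> e) / h\<rfloor> \<le> int N"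
        by linarith+
      then show "k e \<in> {-int N..int N}" using e by (simp add: k_def)
    qed (simp add: k_def)
    have exp: "x = (\<Sum>e\<in>B. (x \<bullet> e) *\<^sub>R e)"
      using orthonormal_basis_expand[OF B(6,5), of x] x(1) B(1,4) by simp
    have "norm (x - g k) = norm (\<Sum>e\<in>B. (x \<bullet> e - of_int (k e) * h) *\<^sub>R e)"
      by (subst (1) exp) (simp add: g_def sum_subtractf scaleR_diff_left)
    also have "\<dots> \<le> (\<Sum>e\<in>B. h)"
    proof (rule sum_norm_le)
      fix e assume e: "e \<in> B"
      have "\<bar>x \<bullet> e / h - of_int (k e)\<bar> \<le> 1" using e by (simp add: k_def) linarith
      then have "\<bar>x \<bullet> e / h - of_int (k e)\<bar> * h \<le> h" using h by simp
      moreover have "\<bar>x \<bullet> e - of_int (k e) * h\<bar> = \<bar>x \<bullet> e / h - of_int (k e)\<bar> * h"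
      proof -
        have "x \<bullet> e - of_int (k e) * h = (x \<bullet> e / h - of_int (k e)) * h"
          using h by (simp add: left_diff_distrib)
        then show ?thesis using h by (simp only: abs_mult)
      qed
      ultimately show "norm ((x \<bullet> e - of_int (k e) * h) *\<^sub>R e) \<le> h"
        using B(5)[OF e] by simp
    qed
    also have "\<dots> = real (dim S) * h" using B(2) by simp
    also have "\<dots> \<le> n * h"
      using dim_subset_UNIV[of S] h by (intro mult_right_mono) (auto simp: n_def)
    also have "\<dots> = b" using n by (simp add: h_def)
    finally show "\<exists>z\<in>g ` K. norm (x - z) \<le> b" using \<open>k \<in> K\<close> by blast
  qed
qed

section \<open>Tubes around subspaces and their volumes\<close>

definition tube :: "(real ^ 'n) set \<Rightarrow> real \<Rightarrow> real \<Rightarrow> (real ^ 'n) set" where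
  "tube S a b = {x. norm x \<le> a \<and> infdist x S \<le> b}"

lemma closed_tube: "closed (tube S a b)"
  unfolding tube_def by (intro closed_Collect_conj closed_Collect_le continuous_intros)

text \<open>A subspace is closed, so the distance to it is attained.\<close>

lemma tube_near_point:
  fixes S :: "(real ^ 'n) set"
  assumes "subspace S" "x \<in> tube S a b"
  obtains u where "u \<in> S" "norm (x - u) \<le> b" "norm u \<le> a + b"
proof -
  have "closed S" "S \<noteq> {}" using assms(1) by (auto simp: closed_subspace dest: subspace_0)
  then obtain u where u: "u \<in> S" "infdist x S = dist x u"
    using infdist_attains_inf by metis
  have "norm u \<le> norm x + norm (x - u)"
    using norm_triangle_ineq4[of x "x - u"] by simp
  with u assms(2) show ?thesis
    by (intro that[of u]) (auto simp: tube_def dist_norm)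
qed

text \<open>Common ground for Lebesgue measure on the whole space and on a subspace, with k the
  respective dimension. The space of \<open>lborel_subspace S\<close> is only S, so ambient Borel
  sets have to be cut down to \<open>space M\<close>; measurability of the identity makes this
  possible. The centres z range over the whole ambient type.\<close>

definition ball_growth :: "'a::metric_space measure \<Rightarrow> nat \<Rightarrow> bool" where
  "ball_growth M k \<longleftrightarrow> (\<lambda>x. x) \<in> M \<rightarrow>\<^sub>M borel \<and>
     (\<exists>K\<ge>0. \<forall>z. \<forall>r>0. emeasure M (cball z r \<inter> space M) \<le> ennreal (K * r ^ k))"

lemma ball_growth_sets:
  assumes "ball_growth M k" "A \<in> sets borel"
  shows "A \<inter> space M \<in> sets M"
proof -
  have "(\<lambda>x. x) \<in> M \<rightarrow>\<^sub>M borel" using assms(1) by (simp add: ball_growth_def)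
  from measurable_sets[OF this assms(2)] show ?thesis by simp
qed

lemma ball_growth_sigma_finite:
  assumes "ball_growth M k"
  shows "sigma_finite_measure M"
proof
  \<comment> \<open>\<open>undefined\<close> serves as an arbitrary fixed centre. The radii start at
    1 because growth is controlled for positive radii.\<close>
  let ?A = "range (\<lambda>i::nat. cball undefined (real (Suc i)) \<inter> space M)"
  show "\<exists>A. countable A \<and> A \<subseteq> sets M \<and> \<Union>A = space M \<and> (\<forall>a\<in>A. emeasure M a \<noteq> \<infinity>)"
  proof (intro exI[of _ ?A] conjI ballI)
    show "?A \<subseteq> sets M" using ball_growth_sets[OF assms] by auto
    show "\<Union>?A = space M"
    proof (intro equalityI subsetI)
      fix x assume "x \<in> space M"
      moreover obtain i where "dist undefined x \<le> real i" using real_arch_simple by blast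
      ultimately show "x \<in> \<Union>?A" by (intro UN_I[of i]) auto
    qed auto
    fix a assume "a \<in> ?A"
    then obtain i where a: "a = cball undefined (real (Suc i)) \<inter> space M" by auto
    obtain K where "\<And>z r. 0 < r \<Longrightarrow> emeasure M (cball z r \<inter> space M) \<le> ennreal (K * r ^ k)"
      using assms by (auto simp: ball_growth_def)
    from this[of "real (Suc i)" undefined] show "emeasure M a \<noteq> \<infinity>"
      unfolding a by (metis ennreal_neq_top infinity_ennreal_def of_nat_0_less_iff top.extremum_unique zero_less_Suc)
  qed simp
qed

lemma ball_growth_lborel: "ball_growth (lborel :: (real ^ 'n) measure) CARD('n)"
  unfolding ball_growth_def
proof (intro conjI exI[of _ "unit_ball_vol (real CARD('n))"] allI impI)
  fix z :: "real ^ 'n" and r :: real assume "0 < r"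
  then show "emeasure lborel (cball z r \<inter> space lborel) \<le> ennreal (unit_ball_vol (real CARD('n)) * r ^ CARD('n))"
    by (simp add: emeasure_cball)
qed simp_all

text \<open>By Cauchy-Schwarz, the coordinates of a point of the ball in an orthonormal basis of S
  differ from the inner products of z with the basis by at most r, even if z lies outside S. The
  preimage of the ball under the coordinate map is thus contained in a cube of side
  \<open>2 * r\<close>.\<close>

lemma ball_growth_lborel_subspace:
  fixes S :: "(real ^ 'n) set"
  assumes S: "subspace S"
  shows "ball_growth (lborel_subspace S) (dim S)"
proof -
  define B where "B = (SOME B. orthonormal_basis S B)"
  have ob: "orthonormal_basis S B"
    unfolding B_def using orthonormal_basis_exists[OF S] by (rule someI_ex)
  note B = orthonormal_basis_facts[OF ob]
  define g where "g = (\<lambda>c :: real^'n \<Rightarrow> real. \<Sum>b\<in>B. c b *\<^sub>R b)"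
  define P where "P = (\<Pi>\<^sub>M b\<in>B. (lborel :: real measure))"
  have eq: "lborel_subspace S = distr P (restrict_space borel S) g"
    by (simp add: lborel_subspace_def B_def[symmetric] g_def P_def Let_def)
  have gS: "g c \<in> S" for c
    using S B(3) by (auto simp: g_def intro!: subspace_sum subspace_scale)
  have g: "g \<in> P \<rightarrow>\<^sub>M restrict_space borel S"
  proof (rule measurable_restrict_space2)
    show "g \<in> P \<rightarrow>\<^sub>M borel"
      unfolding g_def P_def
      by (intro borel_measurable_sum borel_measurable_scaleR measurable_const)
         auto
  qed (use gS in auto)
  interpret product_sigma_finite "\<lambda>_ :: real^'n. lborel :: real measure"
    by standard
  show ?thesis
    unfolding ball_growth_def
  proof (intro conjI exI[of _ "2 ^ dim S"] allI impI)
    show "(\<lambda>x. x) \<in> lborel_subspace S \<rightarrow>\<^sub>M borel"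
      unfolding eq by (simp add: measurable_restrict_space1)
    fix z :: "real ^ 'n" and r :: real assume r: "0 < r"
    have "cball z r \<inter> S \<in> sets (restrict_space borel S)"
      by (simp add: sets_restrict_space_iff Int_commute sets_restrict_space)
    then have "emeasure (lborel_subspace S) (cball z r \<inter> space (lborel_subspace S))
        = emeasure P (g -` (cball z r \<inter> S) \<inter> space P)"
      by (simp add: eq emeasure_distr[OF g] space_restrict_space)
    also have "\<dots> \<le> emeasure P (\<Pi>\<^sub>E b\<in>B. {z \<bullet> b - r .. z \<bullet> b + r})"
    proof (rule emeasure_mono)
      show "(\<Pi>\<^sub>E b\<in>B. {z \<bullet> b - r .. z \<bullet> b + r}) \<in> sets P"
        unfolding P_def using B(1) by (intro sets_PiM_I_finite) auto
      show "g -` (cball z r \<inter> S) \<inter> space P \<subseteq> (\<Pi>\<^sub>E b\<in>B. {z \<bullet> b - r .. z \<bullet> b + r})"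
      proof (intro subsetI PiE_I)
        fix c b assume c: "c \<in> g -` (cball z r \<inter> S) \<inter> space P" and b: "b \<in> B"
        have "\<bar>(z - g c) \<bullet> b\<bar> \<le> norm (z - g c) * norm b" by (rule Cauchy_Schwarz_ineq2)
        also have "\<dots> \<le> r" using c B(5)[OF b] by (simp add: dist_norm)
        finally have "\<bar>z \<bullet> b - c b\<bar> \<le> r"
          using orthonormal_basis_inner_sum[OF ob b, of c] by (simp add: g_def inner_diff_left)
        then show "c b \<in> {z \<bullet> b - r .. z \<bullet> b + r}" by auto
      qed (auto simp: P_def space_PiM PiE_def extensional_def)
    qed
    also have "\<dots> = (\<Prod>b\<in>B. ennreal (2 * r))"
      unfolding P_def using B(1) r by (subst emeasure_PiM) auto
    also have "\<dots> = ennreal (2 ^ dim S * r ^ dim S)"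
      using r B(2) by (simp add: ennreal_power power_mult_distrib)
    finally show "emeasure (lborel_subspace S) (cball z r \<inter> space (lborel_subspace S))
        \<le> ennreal (2 ^ dim S * r ^ dim S)" .
  qed simp
qed

text \<open>Each point of the tube is within b of a point of S of norm at most
  \<open>a + b \<le> 2 * a\<close>, which in turn is within b of a net of the ball of radius
  \<open>2 * a\<close> in S. So balls of radius \<open>2 * b\<close> around the net cover the tube;
  their number is at most a multiple of \<open>(a / b) ^ dim S\<close>, and each has measure at most
  a multiple of \<open>b ^ d\<close>.\<close>

lemma emeasure_tube_le:
  fixes S :: "(real ^ 'n) set"
  assumes S: "subspace S" and M: "ball_growth M d"
  obtains K where "K > 0"
    "\<And>a b. 0 < b \<Longrightarrow> b \<le> a \<Longrightarrow>
      emeasure M (tube S a b \<inter> space M) \<le> ennreal (K * (b ^ d * (a / b) ^ dim S))"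
proof -
  obtain K where K: "K \<ge> 0"
    "\<And>z r. 0 < r \<Longrightarrow> emeasure M (cball z r \<inter> space M) \<le> ennreal (K * r ^ d)"
    using M by (auto simp: ball_growth_def)
  \<comment> \<open>D vanishes if K does, so the positive constant offered below is
    \<open>D + 1\<close>.\<close>
  define D where "D = (5 * real CARD('n)) ^ dim S * 2 ^ dim S * (K * 2 ^ d)"
  have D: "D \<ge> 0" using K by (simp add: D_def)
  show ?thesis
  proof (rule that[of "D + 1"])
    fix a b :: real assume ab: "0 < b" "b \<le> a"
    obtain Z where Z: "finite Z" "Z \<subseteq> S"
      "real (card Z) \<le> (5 * real CARD('n)) ^ dim S * (2 * a / b) ^ dim S"
      "\<And>x. x \<in> S \<Longrightarrow> norm x \<le> 2 * a \<Longrightarrow> \<exists>z\<in>Z. norm (x - z) \<le> b"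
      using subspace_covering[OF S, of b "2 * a"] ab by auto
    have "tube S a b \<inter> space M \<subseteq> (\<Union>z\<in>Z. cball z (2 * b) \<inter> space M)"
    proof
      fix x assume x: "x \<in> tube S a b \<inter> space M"
      then obtain u where u: "u \<in> S" "norm (x - u) \<le> b" "norm u \<le> a + b"
        using tube_near_point[OF S] by blast
      then obtain z where z: "z \<in> Z" "norm (u - z) \<le> b"
        using Z(4)[of u] ab by force
      have "norm (x - z) \<le> 2 * b"
        using norm_triangle_ineq[of "x - u" "u - z"] u z by simp
      then show "x \<in> (\<Union>z\<in>Z. cball z (2 * b) \<inter> space M)"
        using z x by (auto simp: dist_norm norm_minus_commute)
    qed
    then have "emeasure M (tube S a b \<inter> space M) \<le> emeasure M (\<Union>z\<in>Z. cball z (2 * b) \<inter> space M)"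
      by (intro emeasure_mono) (auto intro!: sets.finite_UN Z(1) ball_growth_sets[OF M])
    also have "\<dots> \<le> (\<Sum>z\<in>Z. emeasure M (cball z (2 * b) \<inter> space M))"
      by (intro emeasure_subadditive_finite Z(1)) (auto intro!: ball_growth_sets[OF M])
    also have "\<dots> \<le> (\<Sum>z\<in>Z. ennreal (K * (2 * b) ^ d))"
      using ab by (intro sum_mono K(2)) auto
    also have "\<dots> = ennreal (real (card Z) * (K * (2 * b) ^ d))"
      using K(1) ab by (simp add: ennreal_mult ennreal_of_nat_eq_real_of_nat)
    also have "\<dots> \<le> ennreal (((5 * real CARD('n)) ^ dim S * (2 * a / b) ^ dim S) * (K * (2 * b) ^ d))"
      using Z(3) K(1) ab by (intro ennreal_leI mult_right_mono) auto
    also have "\<dots> = ennreal (D * (b ^ d * (a / b) ^ dim S))"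
      by (simp add: D_def power_mult_distrib power_divide mult_ac)
    also have "\<dots> \<le> ennreal ((D + 1) * (b ^ d * (a / b) ^ dim S))"
      using ab by (intro ennreal_leI mult_right_mono) auto
    finally show "emeasure M (tube S a b \<inter> space M) \<le> ennreal ((D + 1) * (b ^ d * (a / b) ^ dim S))" .
  qed (use D in simp)
qed

text \<open>A ball of radius \<open>a / 2\<close> is covered by boundedly many times \<open>(a / b) ^ dim (S\<^sup>\<bottom>)\<close> translates of the tube.\<close>
lemma emeasure_tube_ge:
  fixes S :: "(real ^ 'n) set"
  assumes S: "subspace S"
  obtains K where "K > 0"
    "\<And>a b. 0 < b \<Longrightarrow> b \<le> a \<Longrightarrow>
      ennreal (K * (b ^ CARD('n) * (a / b) ^ dim S)) \<le> emeasure lborel (tube S a b)"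
proof -
  let ?n = "CARD('n)"
  have So: "subspace (S\<^sup>\<bottom>)" by (rule subspace_orthogonal_comp)
  have dS: "dim (S\<^sup>\<bottom>) = ?n - dim S" "dim S \<le> ?n"
    using dim_subspace_orthogonal_to_vectors[OF S subspace_UNIV] dim_subset_UNIV[of S]
    by (auto simp: orthogonal_comp_def)
  define v where "v = unit_ball_vol (real ?n)"
  define D where "D = (5 * real ?n) ^ dim (S\<^sup>\<bottom>)"
  have v: "v > 0" by (simp add: v_def)
  have D: "D > 0" by (simp add: D_def)
  define K where "K = v / 2 ^ ?n / D"
  show ?thesis
  proof (rule that[of K])
    show "K > 0" using v D by (simp add: K_def)
    fix a b :: real assume ab: "0 < b" "b \<le> a"
    let ?T = "tube S a b"
    obtain Z where Z: "finite Z" "Z \<subseteq> S\<^sup>\<bottom>"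
      "real (card Z) \<le> D * (a / b) ^ dim (S\<^sup>\<bottom>)"
      "\<And>x. x \<in> S\<^sup>\<bottom> \<Longrightarrow> norm x \<le> a / 2 \<Longrightarrow> \<exists>z\<in>Z. norm (x - z) \<le> b / 2"
      using subspace_covering[OF So, of "b / 2" "a / 2"] ab by (auto simp: D_def)
    \<comment> \<open>Write x = u + w along S and its orthogonal complement. By Pythagoras both
      parts have norm at most \<open>a / 2\<close>; subtracting a net point z close to w leaves a
      point within \<open>b / 2\<close> of u and of norm at most
      \<open>a / 2 + b / 2 \<le> a\<close>.\<close>
    have "cball 0 (a / 2) \<subseteq> (\<Union>z\<in>Z. (+) z ` ?T)"
    proof
      fix x :: "real ^ 'n" assume x: "x \<in> cball 0 (a / 2)"
      obtain u w where uw: "u \<in> S" "w \<in> S\<^sup>\<bottom>" "x = u + w"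
        using subspace_sum_orthogonal_comp[OF S] by (metis UNIV_I set_plus_elim)
      have orth: "orthogonal u w" using uw by (auto simp: orthogonal_comp_def)
      have "norm u ^ 2 + norm w ^ 2 = norm x ^ 2"
        using norm_add_Pythagorean[OF orth] uw(3) by simp
      then have "norm u ^ 2 \<le> norm x ^ 2" "norm w ^ 2 \<le> norm x ^ 2"
        using zero_le_power2[of "norm u"] zero_le_power2[of "norm w"] by linarith+
      then have n: "norm u \<le> a / 2" "norm w \<le> a / 2"
        using x power2_le_imp_le[of "norm u" "norm x"] power2_le_imp_le[of "norm w" "norm x"] by auto
      then obtain z where z: "z \<in> Z" "norm (w - z) \<le> b / 2"
        using Z(4) uw(2) by blast
      have "norm (x - z) \<le> a"
        using norm_triangle_ineq[of u "w - z"] n z ab uw(3) by (simp add: algebra_simps)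
      moreover have "infdist (x - z) S \<le> b"
        using z ab uw by (intro infdist_le2[of u]) (auto simp: dist_norm)
      ultimately have "x - z \<in> ?T" by (simp add: tube_def)
      then show "x \<in> (\<Union>z\<in>Z. (+) z ` ?T)" using z(1) by (intro UN_I[of z]) (auto intro: image_eqI[of _ _ "x - z"])
    qed
    moreover have cl: "closed ((+) z ` ?T)" for z using closed_tube closed_translation by blast
    ultimately have "emeasure lborel (cball (0 :: real^'n) (a / 2)) \<le> emeasure lborel (\<Union>z\<in>Z. (+) z ` ?T)"
      using Z(1) by (intro emeasure_mono) (auto intro!: sets.finite_UN)
    also have "\<dots> \<le> (\<Sum>z\<in>Z. emeasure lborel ((+) z ` ?T))"
      using cl by (intro emeasure_subadditive_finite Z(1)) auto
    also have "\<dots> = (\<Sum>z\<in>Z. emeasure lborel ?T)"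
    proof (rule sum.cong)
      fix z
      have "emeasure lborel ((+) z ` ?T) = emeasure (distr lborel borel ((+) z)) ((+) z ` ?T)"
        by (simp add: lborel_distr_plus)
      also have "\<dots> = emeasure lborel ((+) z -` ((+) z ` ?T))"
        using cl by (subst emeasure_distr) auto
      also have "(+) z -` ((+) z ` ?T) = ?T" by (simp add: inj_vimage_image_eq)
      finally show "emeasure lborel ((+) z ` ?T) = emeasure lborel ?T" .
    qed simp
    also have "\<dots> = ennreal (real (card Z)) * emeasure lborel ?T"
      by (simp add: ennreal_of_nat_eq_real_of_nat)
    also have "\<dots> \<le> ennreal (D * (a / b) ^ dim (S\<^sup>\<bottom>)) * emeasure lborel ?T"
      using Z(3) by (intro mult_right_mono ennreal_leI) auto
    finally have le: "ennreal (v * (a / 2) ^ ?n) \<le> ennreal (D * (a / b) ^ dim (S\<^sup>\<bottom>)) * emeasure lborel ?T"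
      using ab by (simp add: emeasure_cball v_def)
    define q where "q = D * (a / b) ^ dim (S\<^sup>\<bottom>)"
    have q: "q > 0" using D ab by (simp add: q_def)
    \<comment> \<open>The dimensions of S and its complement add up to that of the space, so
      dividing \<open>a ^ n\<close> by \<open>(a / b) ^ dim (S\<^sup>\<bottom>)\<close> leaves
      \<open>b ^ n * (a / b) ^ dim S\<close>.\<close>
    have eq: "K * (b ^ ?n * (a / b) ^ dim S) = (v * (a / 2) ^ ?n) / q"
    proof -
      have "(a / b) ^ ?n = (a / b) ^ dim S * (a / b) ^ dim (S\<^sup>\<bottom>)"
        using dS by (simp add: power_add[symmetric])
      moreover have "a ^ ?n = b ^ ?n * (a / b) ^ ?n" using ab by (simp add: power_divide)
      moreover have "v / 2 ^ ?n / D * (B * X) = v * (B * (X * Y) / 2 ^ ?n) / (D * Y)"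
        if "Y > 0" for B X Y :: real using D that by (simp add: field_simps)
      from this[of "(a / b) ^ dim (S\<^sup>\<bottom>)"]
      have "v / 2 ^ ?n / D * (b ^ ?n * (a / b) ^ dim S) =
        v * (b ^ ?n * ((a / b) ^ dim S * (a / b) ^ dim (S\<^sup>\<bottom>)) / 2 ^ ?n) / (D * (a / b) ^ dim (S\<^sup>\<bottom>))"
        using ab by simp
      ultimately show ?thesis
        by (simp only: K_def q_def power_divide[of a 2])
    qed
    have "ennreal ((v * (a / 2) ^ ?n) / q) = ennreal (1 / q) * ennreal (v * (a / 2) ^ ?n)"
      using q v ab by (simp add: ennreal_mult[symmetric])
    also have "\<dots> \<le> ennreal (1 / q) * (ennreal q * emeasure lborel ?T)"
      using le by (intro mult_left_mono) (auto simp: q_def)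
    also have "\<dots> = emeasure lborel ?T"
      using q by (simp add: mult.assoc[symmetric] ennreal_mult[symmetric])
    finally show "ennreal (K * (b ^ CARD('n) * (a / b) ^ dim S)) \<le> emeasure lborel ?T"
      by (simp add: eq)
  qed
qed

section \<open>Sheared boxes and continuous cutoff functions\<close>

text \<open>The shear parameter \<open>\<sigma>\<close> is \<open>0\<close> for the test set itself and \<open>\<plusminus>1/2\<close> for its images under \<^const>\<open>heis_proj\<close>.\<close>
definition heis_box ::
  "(real ^ 'n) set \<Rightarrow> (real ^ 'n) set \<Rightarrow> real \<Rightarrow> real \<Rightarrow> real \<Rightarrow> real \<Rightarrow> real \<Rightarrow> real \<Rightarrow> 'n heis set" where
  "heis_box S T a b c d \<tau> \<sigma> =
     {(x, y, t). x \<in> tube S a b \<and> y \<in> tube T c d \<and> \<bar>t + \<sigma> * (x \<bullet> y)\<bar> \<le> \<tau>}"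

text \<open>For positive sizes, the sublevel set at r is the box with all five sizes multiplied by r
  and the same shear. This reduces the cutoff to a function of one real variable.\<close>

definition heis_gauge ::
  "(real ^ 'n) set \<Rightarrow> (real ^ 'n) set \<Rightarrow> real \<Rightarrow> real \<Rightarrow> real \<Rightarrow> real \<Rightarrow> real \<Rightarrow> real \<Rightarrow> 'n heis \<Rightarrow> real" where
  "heis_gauge S T a b c d \<tau> \<sigma> z =
     max (max (norm (fst z) / a) (infdist (fst z) S / b))
      (max (max (norm (fst (snd z)) / c) (infdist (fst (snd z)) T / d))
        (\<bar>snd (snd z) + \<sigma> * (fst z \<bullet> fst (snd z))\<bar> / \<tau>))"

text \<open>A continuous substitute for the indicator of the box: it is 1 on the box and 0 outside
  the box with doubled sizes.\<close>

definition heis_cutoff ::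
  "(real ^ 'n) set \<Rightarrow> (real ^ 'n) set \<Rightarrow> real \<Rightarrow> real \<Rightarrow> real \<Rightarrow> real \<Rightarrow> real \<Rightarrow> real \<Rightarrow> 'n heis \<Rightarrow> real" where
  "heis_cutoff S T a b c d \<tau> \<sigma> z = max 0 (min 1 (2 - heis_gauge S T a b c d \<tau> \<sigma> z))"

lemma heis_gauge_le_iff:
  assumes "0 < a" "0 < b" "0 < c" "0 < d" "0 < \<tau>"
  shows "heis_gauge S T a b c d \<tau> \<sigma> z \<le> r \<longleftrightarrow>
    z \<in> heis_box S T (r * a) (r * b) (r * c) (r * d) (r * \<tau>) \<sigma>"
  using assms by (cases z) (auto simp: heis_gauge_def heis_box_def tube_def divide_le_eq)

lemma heis_cutoff_bounds: "0 \<le> heis_cutoff S T a b c d \<tau> \<sigma> z" "heis_cutoff S T a b c d \<tau> \<sigma> z \<le> 1"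
  by (auto simp: heis_cutoff_def)

lemma heis_cutoff_eq_1:
  assumes "0 < a" "0 < b" "0 < c" "0 < d" "0 < \<tau>" "z \<in> heis_box S T a b c d \<tau> \<sigma>"
  shows "heis_cutoff S T a b c d \<tau> \<sigma> z = 1"
  using heis_gauge_le_iff[OF assms(1-5), of S T \<sigma> z 1] assms(6) by (auto simp: heis_cutoff_def)

lemma heis_cutoff_support:
  assumes "0 < a" "0 < b" "0 < c" "0 < d" "0 < \<tau>" "heis_cutoff S T a b c d \<tau> \<sigma> z \<noteq> 0"
  shows "z \<in> heis_box S T (2 * a) (2 * b) (2 * c) (2 * d) (2 * \<tau>) \<sigma>"
  using heis_gauge_le_iff[OF assms(1-5), of S T \<sigma> z 2] assms(6)
  by (auto simp: heis_cutoff_def max_def min_def split: if_splits)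

lemma continuous_on_heis_cutoff:
  fixes S T :: "(real ^ 'n) set"
  shows "continuous_on A (heis_cutoff S T a b c d \<tau> \<sigma>)"
proof -
  have 1: "heis_cutoff S T a b c d \<tau> \<sigma> = (\<lambda>z. max 0 (min 1 (2 - heis_gauge S T a b c d \<tau> \<sigma> z)))"
    by (simp add: fun_eq_iff heis_cutoff_def)
  \<comment> \<open>Division by a constant is multiplication by its inverse, hence continuous also
    for r = 0, where the inverse is 0 by convention.\<close>
  have 2: "continuous_on A (\<lambda>z. f z / r)" if "continuous_on A f" for f :: "'n heis \<Rightarrow> real" and r
    using continuous_on_mult_right[OF that, of "inverse r"] by (simp add: divide_inverse)
  have 3: "continuous_on A (heis_gauge S T a b c d \<tau> \<sigma>)"
    unfolding heis_gauge_def by (intro continuous_intros 2)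
  show ?thesis unfolding 1 by (intro continuous_intros 3)
qed

lemma closed_heis_box: "closed (heis_box S T a b c d \<tau> \<sigma>)"
proof -
  have *: "heis_box S T a b c d \<tau> \<sigma> = {z. norm (fst z) \<le> a \<and> infdist (fst z) S \<le> b \<and>
    norm (fst (snd z)) \<le> c \<and> infdist (fst (snd z)) T \<le> d \<and>
    \<bar>snd (snd z) + \<sigma> * (fst z \<bullet> fst (snd z))\<bar> \<le> \<tau>}"
    by (auto simp: heis_box_def tube_def)
  show ?thesis
    unfolding * by (intro closed_Collect_conj closed_Collect_le continuous_intros)
qed

lemma bounded_heis_box: "bounded (heis_box S T a b c d \<tau> \<sigma>)"
proof (rule bounded_subset)
  show "bounded (cball (0 :: real^'n) a \<times> cball (0 :: real^'n) c \<times> cball (0::real) (\<tau> + \<bar>\<sigma>\<bar> * (a * c)))"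
    by (intro bounded_Times bounded_cball)
  show "heis_box S T a b c d \<tau> \<sigma> \<subseteq> cball 0 a \<times> cball 0 c \<times> cball 0 (\<tau> + \<bar>\<sigma>\<bar> * (a * c))"
  proof
    fix z assume "z \<in> heis_box S T a b c d \<tau> \<sigma>"
    then obtain x y t where z: "z = (x, y, t)" "norm x \<le> a" "norm y \<le> c" "\<bar>t + \<sigma> * (x \<bullet> y)\<bar> \<le> \<tau>"
      by (auto simp: heis_box_def tube_def)
    have "\<bar>x \<bullet> y\<bar> \<le> norm x * norm y" by (rule Cauchy_Schwarz_ineq2)
    also have "\<dots> \<le> a * c"
      using z norm_ge_zero[of x] norm_ge_zero[of y] by (intro mult_mono) linarith+
    finally have "\<bar>\<sigma> * (x \<bullet> y)\<bar> \<le> \<bar>\<sigma>\<bar> * (a * c)" by (simp add: abs_mult mult_left_mono)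
    with z show "z \<in> cball 0 a \<times> cball 0 c \<times> cball 0 (\<tau> + \<bar>\<sigma>\<bar> * (a * c))"
      by auto
  qed
qed

lemma nonneg_Cc_on_heis_cutoff:
  assumes "0 < a" "0 < b" "0 < c" "0 < d" "0 < \<tau>"
  shows "nonneg_Cc_on D (heis_cutoff S T a b c d \<tau> \<sigma>)"
proof -
  have "support_on D (heis_cutoff S T a b c d \<tau> \<sigma>)
      \<subseteq> heis_box S T (2 * a) (2 * b) (2 * c) (2 * d) (2 * \<tau>) \<sigma>"
    using heis_cutoff_support[OF assms] by (auto simp: support_on_def)
  then have "bounded (support_on D (heis_cutoff S T a b c d \<tau> \<sigma>))"
    using bounded_heis_box bounded_subset by blast
  then show ?thesis
    by (simp add: nonneg_Cc_on_def continuous_on_heis_cutoff heis_cutoff_bounds compact_closure)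
qed

section \<open>Volumes of sheared boxes and L^p norms of bounded functions\<close>

lemma ident_measurable_pair:
  fixes M :: "'a::second_countable_topology measure" and N :: "'b::second_countable_topology measure"
  assumes "(\<lambda>x. x) \<in> M \<rightarrow>\<^sub>M borel" "(\<lambda>x. x) \<in> N \<rightarrow>\<^sub>M borel"
  shows "(\<lambda>z. z) \<in> M \<Otimes>\<^sub>M N \<rightarrow>\<^sub>M borel"
proof -
  have "(\<lambda>z. (fst z, snd z)) \<in> M \<Otimes>\<^sub>M N \<rightarrow>\<^sub>M borel \<Otimes>\<^sub>M borel"
    by (intro measurable_Pair measurable_compose[OF measurable_fst assms(1)]
        measurable_compose[OF measurable_snd assms(2)])
  then show ?thesis by (simp add: borel_prod)
qed

text \<open>For fixed x and y the shear merely translates the interval of admissible t, whose length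
  stays \<open>2 * \<tau>\<close>. Tonelli then gives a bound independent of \<sigma>.
  \<open>M1\<close> and \<open>M2\<close> stand for Lebesgue measure on the whole space or on one of
  the subspaces.\<close>

lemma emeasure_heis_box_le_product:
  fixes M1 M2 :: "(real ^ 'n) measure"
  assumes M: "ball_growth M1 k1" "ball_growth M2 k2" and \<tau>: "\<tau> \<ge> 0"
  shows "emeasure (M1 \<Otimes>\<^sub>M (M2 \<Otimes>\<^sub>M lborel)) (heis_box S T a b c d \<tau> \<sigma> \<inter> space (M1 \<Otimes>\<^sub>M (M2 \<Otimes>\<^sub>M lborel)))
    \<le> emeasure M1 (tube S a b \<inter> space M1) * (emeasure M2 (tube T c d \<inter> space M2) * ennreal (2 * \<tau>))"
proof -
  let ?L = "lborel :: real measure"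
  let ?A = "tube S a b \<inter> space M1" and ?B = "tube T c d \<inter> space M2"
  let ?X = "heis_box S T a b c d \<tau> \<sigma> \<inter> space (M1 \<Otimes>\<^sub>M (M2 \<Otimes>\<^sub>M ?L))"
  interpret M1: sigma_finite_measure M1 by (rule ball_growth_sigma_finite[OF M(1)])
  interpret M2: sigma_finite_measure M2 by (rule ball_growth_sigma_finite[OF M(2)])
  interpret P: sigma_finite_measure "M2 \<Otimes>\<^sub>M ?L"
    by (intro sigma_finite_pair_measure M2.sigma_finite_measure_axioms sigma_finite_lborel)
  have id: "(\<lambda>x. x) \<in> M1 \<rightarrow>\<^sub>M borel" "(\<lambda>x. x) \<in> M2 \<rightarrow>\<^sub>M borel" "(\<lambda>x. x) \<in> ?L \<rightarrow>\<^sub>M borel"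
    using M by (auto simp: ball_growth_def)
  have AB: "?A \<in> sets M1" "?B \<in> sets M2"
    using ball_growth_sets[OF M(1)] ball_growth_sets[OF M(2)] by (auto simp: closed_tube)
  have X: "?X \<in> sets (M1 \<Otimes>\<^sub>M (M2 \<Otimes>\<^sub>M ?L))"
    using measurable_sets[OF ident_measurable_pair[OF id(1) ident_measurable_pair[OF id(2,3)]], of "heis_box S T a b c d \<tau> \<sigma>"]
    by (simp add: closed_heis_box)
  have slice: "emeasure (M2 \<Otimes>\<^sub>M ?L) (Pair x -` ?X) \<le> emeasure M2 ?B * ennreal (2 * \<tau>) * indicator ?A x" for x
  proof (cases "x \<in> ?A")
    case False
    then have "Pair x -` ?X = {}" by (auto simp: heis_box_def space_pair_measure)
    then show ?thesis by simp
  next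
    case True
    have Y: "Pair x -` ?X \<in> sets (M2 \<Otimes>\<^sub>M ?L)" using X by (rule sets_Pair1)
    have "emeasure (M2 \<Otimes>\<^sub>M ?L) (Pair x -` ?X) = (\<integral>\<^sup>+y. emeasure ?L (Pair y -` (Pair x -` ?X)) \<partial>M2)"
      by (rule lborel.emeasure_pair_measure_alt[OF Y])
    also have "\<dots> \<le> (\<integral>\<^sup>+y. ennreal (2 * \<tau>) * indicator ?B y \<partial>M2)"
    proof (rule nn_integral_mono)
      fix y
      show "emeasure ?L (Pair y -` (Pair x -` ?X)) \<le> ennreal (2 * \<tau>) * indicator ?B y"
      proof (cases "y \<in> ?B")
        case False
        then have "Pair y -` (Pair x -` ?X) = {}" by (auto simp: heis_box_def space_pair_measure)
        then show ?thesis by simp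
      next
        case yB: True
        have "emeasure ?L (Pair y -` (Pair x -` ?X)) \<le> emeasure ?L {- \<tau> - \<sigma> * (x \<bullet> y) .. \<tau> - \<sigma> * (x \<bullet> y)}"
          by (rule emeasure_mono) (auto simp: heis_box_def)
        also have "\<dots> = ennreal (2 * \<tau>)" using \<tau> by simp
        finally show ?thesis using yB by simp
      qed
    qed
    also have "\<dots> = ennreal (2 * \<tau>) * emeasure M2 ?B"
      by (rule nn_integral_cmult_indicator[OF AB(2)])
    finally show ?thesis using True by (simp add: mult.commute)
  qed
  have "emeasure (M1 \<Otimes>\<^sub>M (M2 \<Otimes>\<^sub>M ?L)) ?X = (\<integral>\<^sup>+x. emeasure (M2 \<Otimes>\<^sub>M ?L) (Pair x -` ?X) \<partial>M1)"
    by (rule P.emeasure_pair_measure_alt[OF X])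
  also have "\<dots> \<le> (\<integral>\<^sup>+x. emeasure M2 ?B * ennreal (2 * \<tau>) * indicator ?A x \<partial>M1)"
    by (intro nn_integral_mono slice)
  also have "\<dots> = emeasure M2 ?B * ennreal (2 * \<tau>) * emeasure M1 ?A"
    by (rule nn_integral_cmult_indicator[OF AB(1)])
  finally show ?thesis by (simp add: mult_ac)
qed

lemma emeasure_heis_box_le:
  fixes M1 M2 :: "(real ^ 'n) measure"
  assumes M: "ball_growth M1 k1" "ball_growth M2 k2" and S: "subspace S" "subspace T"
  obtains K where "K > 0"
    "\<And>a b c d \<tau> \<sigma>. 0 < b \<Longrightarrow> b \<le> a \<Longrightarrow> 0 < d \<Longrightarrow> d \<le> c \<Longrightarrow> 0 < \<tau> \<Longrightarrow>
      emeasure (M1 \<Otimes>\<^sub>M (M2 \<Otimes>\<^sub>M lborel)) (heis_box S T a b c d \<tau> \<sigma> \<inter> space (M1 \<Otimes>\<^sub>M (M2 \<Otimes>\<^sub>M lborel)))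
      \<le> ennreal (K * ((b ^ k1 * (a / b) ^ dim S) * (d ^ k2 * (c / d) ^ dim T) * \<tau>))"
proof -
  obtain K1 where K1: "K1 > 0" "\<And>a b. 0 < b \<Longrightarrow> b \<le> a \<Longrightarrow>
      emeasure M1 (tube S a b \<inter> space M1) \<le> ennreal (K1 * (b ^ k1 * (a / b) ^ dim S))"
    using emeasure_tube_le[OF S(1) M(1)] by metis
  obtain K2 where K2: "K2 > 0" "\<And>a b. 0 < b \<Longrightarrow> b \<le> a \<Longrightarrow>
      emeasure M2 (tube T a b \<inter> space M2) \<le> ennreal (K2 * (b ^ k2 * (a / b) ^ dim T))"
    using emeasure_tube_le[OF S(2) M(2)] by metis
  show ?thesis
  proof (rule that[of "2 * K1 * K2"])
    fix a b c d \<tau> \<sigma> :: real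
    assume p: "0 < b" "b \<le> a" "0 < d" "d \<le> c" "0 < \<tau>"
    let ?u = "b ^ k1 * (a / b) ^ dim S" and ?v = "d ^ k2 * (c / d) ^ dim T"
    have uv: "0 \<le> ?u" "0 \<le> ?v" using p by auto
    have "emeasure (M1 \<Otimes>\<^sub>M (M2 \<Otimes>\<^sub>M lborel)) (heis_box S T a b c d \<tau> \<sigma> \<inter> space (M1 \<Otimes>\<^sub>M (M2 \<Otimes>\<^sub>M lborel)))
      \<le> ennreal (K1 * ?u) * (ennreal (K2 * ?v) * ennreal (2 * \<tau>))"
      using p by (intro order_trans[OF emeasure_heis_box_le_product[OF M]] mult_mono K1(2) K2(2)) auto
    also have "\<dots> = ennreal ((K1 * ?u) * ((K2 * ?v) * (2 * \<tau>)))"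
      using K1(1) K2(1) p uv by (simp only: ennreal_mult[symmetric] mult_nonneg_nonneg less_imp_le zero_le_numeral)
    also have "(K1 * ?u) * ((K2 * ?v) * (2 * \<tau>)) = 2 * K1 * K2 * (?u * ?v * \<tau>)"
      by (simp only: mult_ac)
    finally show "emeasure (M1 \<Otimes>\<^sub>M (M2 \<Otimes>\<^sub>M lborel)) (heis_box S T a b c d \<tau> \<sigma> \<inter> space (M1 \<Otimes>\<^sub>M (M2 \<Otimes>\<^sub>M lborel)))
      \<le> ennreal (2 * K1 * K2 * (?u * ?v * \<tau>))" .
  qed (use K1 K2 in simp)
qed

lemma emeasure_lborel_Times:
  fixes A :: "'a::euclidean_space set" and B :: "'b::euclidean_space set"
  assumes "A \<in> sets borel" "B \<in> sets borel"
  shows "emeasure lborel (A \<times> B) = emeasure lborel A * emeasure lborel B"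
  using lborel.emeasure_pair_measure_Times[of A lborel B] assms by (simp add: lborel_prod)

text \<open>Without shear the box is a product of two tubes and an interval, so the lower bounds for
  the tubes multiply.\<close>

lemma emeasure_heis_box_ge:
  fixes S T :: "(real ^ 'n) set"
  assumes S: "subspace S" "subspace T"
  obtains K where "K > 0"
    "\<And>a b c d \<tau>. 0 < b \<Longrightarrow> b \<le> a \<Longrightarrow> 0 < d \<Longrightarrow> d \<le> c \<Longrightarrow> 0 < \<tau> \<Longrightarrow>
      ennreal (K * ((b ^ CARD('n) * (a / b) ^ dim S) * (d ^ CARD('n) * (c / d) ^ dim T) * \<tau>))
      \<le> emeasure lborel (heis_box S T a b c d \<tau> 0)"
proof -
  obtain K1 where K1: "K1 > 0" "\<And>a b. 0 < b \<Longrightarrow> b \<le> a \<Longrightarrow>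
      ennreal (K1 * (b ^ CARD('n) * (a / b) ^ dim S)) \<le> emeasure lborel (tube S a b)"
    using emeasure_tube_ge[OF S(1)] by metis
  obtain K2 where K2: "K2 > 0" "\<And>a b. 0 < b \<Longrightarrow> b \<le> a \<Longrightarrow>
      ennreal (K2 * (b ^ CARD('n) * (a / b) ^ dim T)) \<le> emeasure lborel (tube T a b)"
    using emeasure_tube_ge[OF S(2)] by metis
  show ?thesis
  proof (rule that[of "2 * K1 * K2"])
    fix a b c d \<tau> :: real
    assume p: "0 < b" "b \<le> a" "0 < d" "d \<le> c" "0 < \<tau>"
    let ?u = "b ^ CARD('n) * (a / b) ^ dim S" and ?v = "d ^ CARD('n) * (c / d) ^ dim T"
    have uv: "0 \<le> ?u" "0 \<le> ?v" using p by auto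
    have "2 * K1 * K2 * (?u * ?v * \<tau>) = (K1 * ?u) * ((K2 * ?v) * (2 * \<tau>))"
      by (simp only: mult_ac)
    also have "ennreal \<dots> = ennreal (K1 * ?u) * (ennreal (K2 * ?v) * ennreal (2 * \<tau>))"
      using K1(1) K2(1) p uv by (simp only: ennreal_mult mult_nonneg_nonneg less_imp_le zero_le_numeral)
    also have "\<dots> \<le> emeasure lborel (tube S a b) * (emeasure lborel (tube T c d) * emeasure lborel {-\<tau>..\<tau>})"
      using p by (intro mult_mono K1(2) K2(2)) auto
    also have "\<dots> = emeasure lborel (tube S a b \<times> (tube T c d \<times> {-\<tau>..\<tau>}))"
      by (simp add: emeasure_lborel_Times closed_tube borel_closed closed_Times)
    also have "tube S a b \<times> (tube T c d \<times> {-\<tau>..\<tau>}) = heis_box S T a b c d \<tau> 0"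
      by (auto simp: heis_box_def)
    finally show "ennreal (2 * K1 * K2 * (?u * ?v * \<tau>)) \<le> emeasure lborel (heis_box S T a b c d \<tau> 0)" .
  qed (use K1 K2 in simp)
qed

text \<open>As f is at most the indicator of A, so is each positive power of f. For
  \<open>p = \<infinity>\<close> the right-hand side is \<open>v powr 0\<close>, which is 1 because
  v is positive.\<close>

lemma Lp_norm_le_of_support:
  fixes p :: ennreal
  assumes p: "0 < p" and f: "f \<in> borel_measurable M" and bd: "\<And>z. 0 \<le> f z" "\<And>z. f z \<le> 1"
    and A: "A \<in> sets M" "\<And>z. z \<in> space M \<Longrightarrow> f z \<noteq> 0 \<Longrightarrow> z \<in> A"
    and v: "0 < v" "emeasure M A \<le> ennreal v"
  shows "Lp_norm p M f \<le> ennreal (v powr recip p)"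
proof (cases "p = \<infinity>")
  case True
  have "esssup M (\<lambda>z. ennreal \<bar>f z\<bar>) \<le> 1"
    using f bd by (intro esssup_I) (auto simp: ennreal_le_1)
  then show ?thesis using True v by (simp add: Lp_norm_def recip_def)
next
  case False
  then obtain q where q: "p = ennreal q" "q > 0"
    using p by (cases p) (auto simp: top_unique)
  have rec: "recip p = 1 / q"
    using q by (simp add: recip_def divide_ennreal_def inverse_ennreal divide_inverse)
  define I where "I = (\<integral>\<^sup>+ z. ennreal (\<bar>f z\<bar> powr q) \<partial>M)"
  have "I \<le> (\<integral>\<^sup>+ z. indicator A z \<partial>M)"
    unfolding I_def
  proof (rule nn_integral_mono)
    fix z assume z: "z \<in> space M"
    show "ennreal (\<bar>f z\<bar> powr q) \<le> indicator A z"
    proof (cases "f z = 0")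
      case False
      have "\<bar>f z\<bar> powr q \<le> 1" using bd[of z] q by (simp add: powr_le1)
      then show ?thesis using A(2)[OF z False] by simp
    qed simp
  qed
  also have "\<dots> = emeasure M A" using A(1) by simp
  finally have I: "I \<le> ennreal v" using v(2) by simp
  then have "I \<noteq> \<infinity>" using ennreal_less_top neq_top_trans by (metis infinity_ennreal_def less_top)
  have "enn2real I \<le> v" using I v(1) by (simp add: enn2real_leI)
  then have "enn2real I powr (1 / q) \<le> v powr (1 / q)" using q by (intro powr_mono2) auto
  then show ?thesis
    using \<open>I \<noteq> \<infinity>\<close> q by (simp add: Lp_norm_def rec[unfolded q(1)] I_def[symmetric] Let_def ennreal_leI)
qed

section \<open>Orthogonal projections and the images of boxes under \<open>heis_proj\<close>\<close>

lemma orth_proj_works: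
  assumes "subspace S"
  shows "orth_proj S x \<in> S" "v \<in> S \<Longrightarrow> v \<bullet> orth_proj S x = v \<bullet> x"
  using theI'[OF orth_proj_unique[OF assms, of x]]
  by (auto simp: orth_proj_def orthogonal_def inner_diff_right)

lemma orth_proj_eqI:
  assumes "subspace S" "y \<in> S" "\<And>v. v \<in> S \<Longrightarrow> v \<bullet> y = v \<bullet> x"
  shows "orth_proj S x = y"
  unfolding orth_proj_def
  by (rule the1_equality[OF orth_proj_unique[OF assms(1)]])
     (use assms in \<open>auto simp: orthogonal_def inner_diff_right\<close>)

lemma linear_orth_proj:
  assumes S: "subspace S"
  shows "linear (orth_proj S)"
proof (rule linearI)
  show "orth_proj S (x + y) = orth_proj S x + orth_proj S y" for x y
    by (rule orth_proj_eqI[OF S])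
       (auto simp: S orth_proj_works subspace_add inner_add_right)
  show "orth_proj S (c *\<^sub>R x) = c *\<^sub>R orth_proj S x" for c x
    by (rule orth_proj_eqI[OF S]) (auto simp: S orth_proj_works subspace_scale)
qed

lemma norm_orth_proj_le:
  assumes S: "subspace S"
  shows "norm (orth_proj S x) \<le> norm x"
proof -
  have "norm (orth_proj S x) * norm (orth_proj S x) = orth_proj S x \<bullet> x"
    using orth_proj_works[OF S] by (simp flip: power2_eq_square add: power2_norm_eq_inner)
  also have "\<dots> \<le> norm (orth_proj S x) * norm x"
    by (rule norm_cauchy_schwarz)
  finally show ?thesis
    by (cases "orth_proj S x = 0") auto
qed

text \<open>Both forms rest on Lx . Ly = Lx . y = x . Ly. The first involves Lx and y, the
  coordinates kept by the maps with \<open>j \<le> m\<close>; the second involves x and Ly, those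
  kept by the others.\<close>

lemma orth_proj_residual_inner:
  assumes S: "subspace S"
  shows "(x - orth_proj S x) \<bullet> (y - orth_proj S y) = x \<bullet> y - orth_proj S x \<bullet> y"
    "(x - orth_proj S x) \<bullet> (y - orth_proj S y) = x \<bullet> y - x \<bullet> orth_proj S y"
proof -
  have "orth_proj S x \<bullet> orth_proj S y = orth_proj S x \<bullet> y"
    "orth_proj S y \<bullet> orth_proj S x = orth_proj S y \<bullet> x"
    using orth_proj_works[OF S] by auto
  then show "(x - orth_proj S x) \<bullet> (y - orth_proj S y) = x \<bullet> y - orth_proj S x \<bullet> y"
    "(x - orth_proj S x) \<bullet> (y - orth_proj S y) = x \<bullet> y - x \<bullet> orth_proj S y"
    by (simp_all add: inner_diff_left inner_diff_right inner_commute)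
qed

text \<open>A projection is a contraction and maps U onto the new core, so neither the norm nor the
  distance to the core grows. Describing tubes by distances avoids coordinates adapted to the image
  of U.\<close>

lemma orth_proj_tube:
  assumes V: "subspace V" and U: "subspace U" and x: "x \<in> tube U a b"
  shows "orth_proj V x \<in> tube (orth_proj V ` U) a b"
proof -
  obtain u where u: "u \<in> U" "norm (x - u) \<le> b"
    using tube_near_point[OF U x] by blast
  have "dist (orth_proj V x) (orth_proj V u) = norm (orth_proj V (x - u))"
    by (simp add: dist_norm linear_diff[OF linear_orth_proj[OF V]])
  also have "\<dots> \<le> b" using norm_orth_proj_le[OF V, of "x - u"] u by simp
  finally have "infdist (orth_proj V x) (orth_proj V ` U) \<le> b"
    using u by (intro infdist_le2) auto
  then show ?thesis
    using x norm_orth_proj_le[OF V, of x] by (simp add: tube_def)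
qed

text \<open>With u and w close to x and y in U and W, orthogonality gives x . y = (x - u) . y + u .
  (y - w). The first term is at most \<open>b * c\<close>, the second at most
  \<open>2 * a * d\<close> since u has norm at most \<open>a + b\<close>. Without orthogonality only
  a bound of order \<open>a * c\<close> would be available.\<close>

lemma tube_inner_bound:
  fixes U W :: "(real ^ 'n) set"
  assumes U: "subspace U" and W: "subspace W" and orth: "W \<subseteq> U\<^sup>\<bottom>"
    and x: "x \<in> tube U a b" and y: "y \<in> tube W c d"
    and p: "0 < b" "b \<le> a" "0 < d" "d \<le> c" "a * d \<le> \<tau>" "b * c \<le> \<tau>"
  shows "\<bar>x \<bullet> y\<bar> \<le> 3 * \<tau>"
proof -
  obtain u where u: "u \<in> U" "norm (x - u) \<le> b" "norm u \<le> a + b"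
    using tube_near_point[OF U x] by blast
  obtain w where w: "w \<in> W" "norm (y - w) \<le> d"
    using tube_near_point[OF W y] by blast
  have "u \<bullet> w = 0" using u w orth by (auto simp: orthogonal_comp_def orthogonal_def)
  then have "x \<bullet> y = (x - u) \<bullet> y + u \<bullet> (y - w)"
    by (simp add: inner_diff_left inner_diff_right)
  moreover have "\<bar>(x - u) \<bullet> y\<bar> \<le> b * c"
    using y p u by (intro order_trans[OF Cauchy_Schwarz_ineq2] mult_mono) (auto simp: tube_def)
  moreover have "\<bar>u \<bullet> (y - w)\<bar> \<le> (2 * a) * d"
    using p u w by (intro order_trans[OF Cauchy_Schwarz_ineq2] mult_mono) auto
  ultimately show ?thesis using p by linarith
qed

text \<open>If t' is the last coordinate of the image, then t' + Lx . y / 2 = t + x . y / 2 for the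
  first kind of map and t' - x . Ly / 2 = t - x . y / 2 for the second. Both right-hand sides are at
  most \<open>\<tau> + 3 / 2 * \<tau>\<close> in absolute value, which the height
  \<open>3 * \<tau>\<close> accommodates.\<close>

lemma heis_proj_box:
  fixes U W :: "(real ^ 'n) set"
  assumes U: "subspace U" and W: "subspace W" and orth: "W \<subseteq> U\<^sup>\<bottom>" and V: "subspace (V j)"
    and p: "0 < b" "b \<le> a" "0 < d" "d \<le> c" "a * d \<le> \<tau>" "b * c \<le> \<tau>"
    and z: "z \<in> heis_box U W a b c d \<tau> 0"
  shows "heis_proj m V j z \<in>
    (if j \<le> m then heis_box (orth_proj (V j) ` U) W a b c d (3 * \<tau>) (1/2)
     else heis_box U (orth_proj (V j) ` W) a b c d (3 * \<tau>) (-1/2))"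
proof -
  obtain x y t where xyt: "z = (x, y, t)" "x \<in> tube U a b" "y \<in> tube W c d" "\<bar>t\<bar> \<le> \<tau>"
    using z by (auto simp: heis_box_def)
  have "\<bar>x \<bullet> y\<bar> \<le> 3 * \<tau>" by (rule tube_inner_bound[OF U W orth xyt(2,3) p])
  then have xy: "\<bar>t + 1/2 * (x \<bullet> y)\<bar> \<le> 3 * \<tau>" "\<bar>t - 1/2 * (x \<bullet> y)\<bar> \<le> 3 * \<tau>"
    using xyt(4) by linarith+
  show ?thesis
  proof (cases "j \<le> m")
    case True
    have "t + 1/2 * ((x - orth_proj (V j) x) \<bullet> (y - orth_proj (V j) y)) + 1/2 * (orth_proj (V j) x \<bullet> y)
      = t + 1/2 * (x \<bullet> y)"
      unfolding orth_proj_residual_inner(1)[OF V] by (simp add: algebra_simps)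
    then show ?thesis
      using True xyt xy(1) orth_proj_tube[OF V U xyt(2)] by (simp add: heis_proj_def heis_box_def Let_def)
  next
    case False
    have "t - 1/2 * ((x - orth_proj (V j) x) \<bullet> (y - orth_proj (V j) y)) - 1/2 * (x \<bullet> orth_proj (V j) y)
      = t - 1/2 * (x \<bullet> y)"
      unfolding orth_proj_residual_inner(2)[OF V] by (simp add: algebra_simps)
    then show ?thesis
      using False xyt xy(2) orth_proj_tube[OF V W xyt(3)] by (simp add: heis_proj_def heis_box_def Let_def)
  qed
qed

section \<open>Exponential scaling and the resulting linear inequality\<close>

text \<open>The logarithm of the volume of a box, up to an additive constant; \<open>\<alpha>, \<beta>, \<gamma>, \<delta>\<close> are the logarithms of its sizes.\<close>
definition box_weight :: "real \<Rightarrow> real \<Rightarrow> real \<Rightarrow> real \<Rightarrow> real \<Rightarrow> real \<Rightarrow> real \<Rightarrow> real \<Rightarrow> real" where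
  "box_weight k l s t \<alpha> \<beta> \<gamma> \<delta> =
     s * \<alpha> + (k - s) * \<beta> + t * \<gamma> + (l - t) * \<delta> + max (\<alpha> + \<delta>) (\<beta> + \<gamma>)"

lemma box_weight_scale:
  assumes "r \<ge> 0"
  shows "box_weight k l s t (r * \<alpha>) (r * \<beta>) (r * \<gamma>) (r * \<delta>) = r * box_weight k l s t \<alpha> \<beta> \<gamma> \<delta>"
proof -
  have "max (r * \<alpha> + r * \<delta>) (r * \<beta> + r * \<gamma>) = r * max (\<alpha> + \<delta>) (\<beta> + \<gamma>)"
    using assms by (simp add: max_mult_distrib_left distrib_left)
  then show ?thesis by (simp add: box_weight_def algebra_simps)
qed

lemma exp_box_weight:
  "(exp \<beta> ^ k * (exp \<alpha> / exp \<beta>) ^ s) * (exp \<delta> ^ l * (exp \<gamma> / exp \<delta>) ^ t) * exp (max (\<alpha> + \<delta>) (\<beta> + \<gamma>))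
    = exp (box_weight (real k) (real l) (real s) (real t) \<alpha> \<beta> \<gamma> \<delta>)"
  unfolding box_weight_def exp_diff[symmetric] exp_of_nat_mult[symmetric] exp_add[symmetric]
  by (simp add: algebra_simps)

lemma Lp_norm_heis_cutoff_le:
  fixes M1 M2 :: "(real ^ 'n) measure"
  assumes M: "ball_growth M1 k" "ball_growth M2 l" and S: "subspace S" "subspace T" and p: "0 < p"
  obtains K where "K > 0"
    "\<And>\<alpha> \<beta> \<gamma> \<delta> \<sigma>. \<beta> \<le> \<alpha> \<Longrightarrow> \<delta> \<le> \<gamma> \<Longrightarrow>
      Lp_norm p (M1 \<Otimes>\<^sub>M (M2 \<Otimes>\<^sub>M lborel))
        (heis_cutoff S T (exp \<alpha>) (exp \<beta>) (exp \<gamma>) (exp \<delta>) (3 * exp (max (\<alpha> + \<delta>) (\<beta> + \<gamma>))) \<sigma>)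
      \<le> ennreal (K * exp (recip p * box_weight k l (dim S) (dim T) \<alpha> \<beta> \<gamma> \<delta>))"
proof -
  let ?M = "M1 \<Otimes>\<^sub>M (M2 \<Otimes>\<^sub>M (lborel :: real measure))"
  obtain K where K: "K > 0"
    "\<And>a b c d \<tau> \<sigma>. 0 < b \<Longrightarrow> b \<le> a \<Longrightarrow> 0 < d \<Longrightarrow> d \<le> c \<Longrightarrow> 0 < \<tau> \<Longrightarrow>
      emeasure ?M (heis_box S T a b c d \<tau> \<sigma> \<inter> space ?M)
      \<le> ennreal (K * ((b ^ k * (a / b) ^ dim S) * (d ^ l * (c / d) ^ dim T) * \<tau>))"
    using emeasure_heis_box_le[OF M S] by metis
  have id: "(\<lambda>z. z) \<in> ?M \<rightarrow>\<^sub>M borel"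
    using M by (intro ident_measurable_pair) (auto simp: ball_growth_def)
  \<comment> \<open>Doubling all sizes keeps the ratios \<open>a / b\<close> and
    \<open>c / d\<close>, so it costs \<open>2 ^ k\<close> and \<open>2 ^ l\<close> for the two
    tubes; the 6 comes from the height \<open>2 * (3 * \<tau>)\<close>.\<close>
  define D where "D = K * (2 ^ k * 2 ^ l * 6)"
  have D: "D > 0" using K by (simp add: D_def)
  show ?thesis
  proof (rule that[of "D powr recip p"])
    fix \<alpha> \<beta> \<gamma> \<delta> \<sigma> :: real
    assume le: "\<beta> \<le> \<alpha>" "\<delta> \<le> \<gamma>"
    let ?a = "exp \<alpha>" and ?b = "exp \<beta>" and ?c = "exp \<gamma>" and ?d = "exp \<delta>"
    let ?\<tau> = "exp (max (\<alpha> + \<delta>) (\<beta> + \<gamma>))"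
    let ?w = "box_weight k l (dim S) (dim T) \<alpha> \<beta> \<gamma> \<delta>"
    let ?f = "heis_cutoff S T ?a ?b ?c ?d (3 * ?\<tau>) \<sigma>"
    let ?E = "heis_box S T (2 * ?a) (2 * ?b) (2 * ?c) (2 * ?d) (2 * (3 * ?\<tau>)) \<sigma>"
    have "emeasure ?M (?E \<inter> space ?M)
      \<le> ennreal (K * (((2 * ?b) ^ k * ((2 * ?a) / (2 * ?b)) ^ dim S) * ((2 * ?d) ^ l * ((2 * ?c) / (2 * ?d)) ^ dim T) * (2 * (3 * ?\<tau>))))"
      using le by (intro K(2)) auto
    also have "K * (((2 * ?b) ^ k * ((2 * ?a) / (2 * ?b)) ^ dim S) * ((2 * ?d) ^ l * ((2 * ?c) / (2 * ?d)) ^ dim T) * (2 * (3 * ?\<tau>)))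
      = D * ((?b ^ k * (?a / ?b) ^ dim S) * (?d ^ l * (?c / ?d) ^ dim T) * ?\<tau>)"
      by (simp add: D_def power_mult_distrib)
    also have "\<dots> = D * exp ?w" by (simp only: exp_box_weight)
    finally have E: "emeasure ?M (?E \<inter> space ?M) \<le> ennreal (D * exp ?w)" .
    have "Lp_norm p ?M ?f \<le> ennreal ((D * exp ?w) powr recip p)"
    proof (rule Lp_norm_le_of_support[OF p, of _ _ "?E \<inter> space ?M"])
      have "?f \<in> borel_measurable borel"
        by (rule borel_measurable_continuous_onI[OF continuous_on_heis_cutoff])
      from measurable_compose[OF id this] show "?f \<in> borel_measurable ?M" .
      show "?E \<inter> space ?M \<in> sets ?M"
        using measurable_sets[OF id, of ?E] by (simp add: closed_heis_box)
      show "z \<in> ?E \<inter> space ?M" if "z \<in> space ?M" "?f z \<noteq> 0" for z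
        using that heis_cutoff_support[OF _ _ _ _ _ that(2)] by auto
    qed (use D E heis_cutoff_bounds in auto)
    also have "(D * exp ?w) powr recip p = D powr recip p * exp (recip p * ?w)"
      using D by (simp add: powr_mult) (simp add: powr_def)
    finally show "Lp_norm p ?M ?f \<le> ennreal (D powr recip p * exp (recip p * ?w))" .
  qed (use D in simp)
qed

text \<open>The cutoffs are 1 on boxes containing the images of the test box, so the form is at
  least the volume of the test box, while each norm is at most a constant times a box volume to the
  power \<open>1 / p\<close>. Taking logarithms collects all constants in a single \<kappa>,
  independent of the four exponents.\<close>

lemma heis_form_scaling_bound:
  fixes m :: nat and V :: "nat \<Rightarrow> (real ^ 'n) set" and p :: "nat \<Rightarrow> ennreal"
  assumes V: "\<And>j. j \<in> {1..2*m} \<Longrightarrow> subspace (V j)"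
    and p: "\<And>j. j \<in> {1..2*m} \<Longrightarrow> 0 < p j"
    and C: "C < \<infinity>" "\<And>f :: nat \<Rightarrow> 'n heis \<Rightarrow> real.
        (\<And>j. j \<in> {1..2*m} \<Longrightarrow> nonneg_Cc_on (heis_codomain m V j) (f j)) \<Longrightarrow>
        heis_form m V f \<le> C * (\<Prod>j=1..m. Lp_norm (p j) (heis_measure m V j) (f j) *
                               Lp_norm (p (j + m)) (heis_measure m V (j + m)) (f (j + m)))"
    and U: "subspace U" and W: "subspace W" and orth: "W \<subseteq> U\<^sup>\<bottom>"
  obtains \<kappa> where "\<And>\<alpha> \<beta> \<gamma> \<delta>. \<beta> \<le> \<alpha> \<Longrightarrow> \<delta> \<le> \<gamma> \<Longrightarrow>
    box_weight CARD('n) CARD('n) (dim U) (dim W) \<alpha> \<beta> \<gamma> \<delta> \<le> \<kappa> +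
    (\<Sum>j=1..m. recip (p j) * box_weight (dim (V j)) CARD('n) (dim (orth_proj (V j) ` U)) (dim W) \<alpha> \<beta> \<gamma> \<delta>
       + recip (p (j + m)) *
         box_weight CARD('n) (dim (V (j + m))) (dim U) (dim (orth_proj (V (j + m)) ` W)) \<alpha> \<beta> \<gamma> \<delta>)"
proof -
  define S where "S j = (if j \<le> m then orth_proj (V j) ` U else U)" for j
  define T where "T j = (if j \<le> m then W else orth_proj (V j) ` W)" for j
  define k where "k j = (if j \<le> m then dim (V j) else CARD('n))" for j
  define l where "l j = (if j \<le> m then CARD('n) else dim (V j))" for j
  define \<sigma> :: "nat \<Rightarrow> real" where "\<sigma> j = (if j \<le> m then 1/2 else -1/2)" for j
  define F where "F \<alpha> \<beta> \<gamma> \<delta> j =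
    heis_cutoff (S j) (T j) (exp \<alpha>) (exp \<beta>) (exp \<gamma>) (exp \<delta>) (3 * exp (max (\<alpha> + \<delta>) (\<beta> + \<gamma>))) (\<sigma> j)"
    for \<alpha> \<beta> \<gamma> \<delta> j
  define w where "w j = box_weight (k j) (l j) (dim (S j)) (dim (T j))" for j
  \<comment> \<open>The constants are fixed before the exponents, so that they survive the limit of
    large scales.\<close>
  have "\<exists>K>0. \<forall>\<alpha> \<beta> \<gamma> \<delta>. \<beta> \<le> \<alpha> \<longrightarrow> \<delta> \<le> \<gamma> \<longrightarrow>
      Lp_norm (p j) (heis_measure m V j) (F \<alpha> \<beta> \<gamma> \<delta> j) \<le> ennreal (K * exp (recip (p j) * w j \<alpha> \<beta> \<gamma> \<delta>))"
    if j: "j \<in> {1..2*m}" for j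
  proof -
    define M1 where "M1 = (if j \<le> m then lborel_subspace (V j) else lborel)"
    define M2 where "M2 = (if j \<le> m then lborel else lborel_subspace (V j))"
    have "heis_measure m V j = M1 \<Otimes>\<^sub>M (M2 \<Otimes>\<^sub>M lborel)"
      by (simp add: heis_measure_def M1_def M2_def)
    moreover have "ball_growth M1 (k j)" "ball_growth M2 (l j)"
      using ball_growth_lborel ball_growth_lborel_subspace[OF V[OF j]]
      by (auto simp: M1_def M2_def k_def l_def)
    moreover have "subspace (S j)" "subspace (T j)"
      using U W linear_subspace_image[OF linear_orth_proj[OF V[OF j]]]
      by (auto simp: S_def T_def)
    ultimately show ?thesis
      using Lp_norm_heis_cutoff_le[of M1 "k j" M2 "l j" "S j" "T j" "p j"] p[OF j]
      unfolding F_def w_def by metis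
  qed
  then obtain K where K: "\<And>j. j \<in> {1..2*m} \<Longrightarrow> K j > 0"
    "\<And>j \<alpha> \<beta> \<gamma> \<delta>. j \<in> {1..2*m} \<Longrightarrow> \<beta> \<le> \<alpha> \<Longrightarrow> \<delta> \<le> \<gamma> \<Longrightarrow>
      Lp_norm (p j) (heis_measure m V j) (F \<alpha> \<beta> \<gamma> \<delta> j) \<le> ennreal (K j * exp (recip (p j) * w j \<alpha> \<beta> \<gamma> \<delta>))"
    by metis
  obtain K0 where K0: "K0 > 0"
    "\<And>a b c d \<tau>. 0 < b \<Longrightarrow> b \<le> a \<Longrightarrow> 0 < d \<Longrightarrow> d \<le> c \<Longrightarrow> 0 < \<tau> \<Longrightarrow>
      ennreal (K0 * ((b ^ CARD('n) * (a / b) ^ dim U) * (d ^ CARD('n) * (c / d) ^ dim W) * \<tau>))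
      \<le> emeasure lborel (heis_box U W a b c d \<tau> 0)"
    using emeasure_heis_box_ge[OF U W] by metis
  \<comment> \<open>C may be 0; adding 1 makes the logarithm of the final constant
    meaningful.\<close>
  define C' where "C' = enn2real C + 1"
  have C': "C' > 0" by (simp add: C'_def add_nonneg_pos)
  have CC': "C \<le> ennreal C'"
  proof -
    have "C = ennreal (enn2real C)" using C(1) by (simp add: ennreal_enn2real)
    also have "\<dots> \<le> ennreal C'" by (intro ennreal_leI) (simp add: C'_def)
    finally show ?thesis .
  qed
  define KP where "KP = (\<Prod>j=1..m. K j * K (j + m))"
  have Kpos: "K j > 0" "K (j + m) > 0" if "j \<in> {1..m}" for j using that K(1) by auto
  have KP: "KP > 0" unfolding KP_def using Kpos by (intro prod_pos) auto
  show ?thesis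
  proof (rule that[of "ln (C' * KP / K0)"])
    fix \<alpha> \<beta> \<gamma> \<delta> :: real
    assume le: "\<beta> \<le> \<alpha>" "\<delta> \<le> \<gamma>"
    let ?\<tau> = "exp (max (\<alpha> + \<delta>) (\<beta> + \<gamma>))"
    let ?E = "heis_box U W (exp \<alpha>) (exp \<beta>) (exp \<gamma>) (exp \<delta>) ?\<tau> 0"
    let ?f = "F \<alpha> \<beta> \<gamma> \<delta>"
    let ?w0 = "box_weight CARD('n) CARD('n) (dim U) (dim W) \<alpha> \<beta> \<gamma> \<delta>"
    define Q where "Q = (\<Sum>j=1..m. recip (p j) * w j \<alpha> \<beta> \<gamma> \<delta> + recip (p (j + m)) * w (j + m) \<alpha> \<beta> \<gamma> \<delta>)"
    have one: "?f j (heis_proj m V j z) = 1" if j: "j \<in> {1..2*m}" and z: "z \<in> ?E" for j z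
      unfolding F_def
    proof (rule heis_cutoff_eq_1)
      show "heis_proj m V j z \<in> heis_box (S j) (T j) (exp \<alpha>) (exp \<beta>) (exp \<gamma>) (exp \<delta>) (3 * ?\<tau>) (\<sigma> j)"
        using heis_proj_box[of U W V j, OF U W orth V[OF j] _ _ _ _ _ _ z, of m] le
        by (auto simp: S_def T_def \<sigma>_def exp_add[symmetric])
    qed auto
    have "ennreal (K0 * exp ?w0) \<le> emeasure lborel ?E"
      using K0(2)[of "exp \<beta>" "exp \<alpha>" "exp \<delta>" "exp \<gamma>" ?\<tau>] le by (simp only: exp_box_weight) simp
    also have "\<dots> = (\<integral>\<^sup>+z. indicator ?E z \<partial>lborel)"
      by (simp add: closed_heis_box)
    also have "\<dots> \<le> heis_form m V ?f"
      unfolding heis_form_def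
    proof (rule nn_integral_mono)
      fix z
      show "indicator ?E z \<le> ennreal (\<Prod>j=1..2*m. ?f j (heis_proj m V j z))"
        using one[of _ z] by (cases "z \<in> ?E") auto
    qed
    also have "\<dots> \<le> C * (\<Prod>j=1..m. Lp_norm (p j) (heis_measure m V j) (?f j) *
                               Lp_norm (p (j + m)) (heis_measure m V (j + m)) (?f (j + m)))"
      by (rule C(2)) (auto simp: F_def intro!: nonneg_Cc_on_heis_cutoff)
    also have "\<dots> \<le> ennreal C' * (\<Prod>j=1..m. ennreal (K j * exp (recip (p j) * w j \<alpha> \<beta> \<gamma> \<delta>)) *
                               ennreal (K (j + m) * exp (recip (p (j + m)) * w (j + m) \<alpha> \<beta> \<gamma> \<delta>)))"
      using le by (intro mult_mono CC' prod_mono_ennreal K(2)) auto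
    also have "(\<Prod>j=1..m. ennreal (K j * exp (recip (p j) * w j \<alpha> \<beta> \<gamma> \<delta>)) *
                               ennreal (K (j + m) * exp (recip (p (j + m)) * w (j + m) \<alpha> \<beta> \<gamma> \<delta>)))
      = (\<Prod>j=1..m. ennreal ((K j * K (j + m)) *
          exp (recip (p j) * w j \<alpha> \<beta> \<gamma> \<delta> + recip (p (j + m)) * w (j + m) \<alpha> \<beta> \<gamma> \<delta>)))"
      using Kpos by (intro prod.cong) (auto simp: ennreal_mult[symmetric] exp_add less_imp_le mult_ac)
    also have "\<dots> = ennreal (\<Prod>j=1..m. (K j * K (j + m)) *
          exp (recip (p j) * w j \<alpha> \<beta> \<gamma> \<delta> + recip (p (j + m)) * w (j + m) \<alpha> \<beta> \<gamma> \<delta>))"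
      using Kpos by (intro prod_ennreal) (simp add: less_imp_le)
    also have "(\<Prod>j=1..m. (K j * K (j + m)) *
          exp (recip (p j) * w j \<alpha> \<beta> \<gamma> \<delta> + recip (p (j + m)) * w (j + m) \<alpha> \<beta> \<gamma> \<delta>)) = KP * exp Q"
      by (simp add: prod.distrib KP_def Q_def exp_sum)
    also have "ennreal C' * ennreal (KP * exp Q) = ennreal (C' * (KP * exp Q))"
      using C' KP by (simp add: ennreal_mult)
    finally have "K0 * exp ?w0 \<le> C' * (KP * exp Q)"
      using C' KP by (simp add: ennreal_le_iff)
    then have "exp ?w0 \<le> (C' * KP / K0) * exp Q"
      using K0(1) by (simp add: field_simps)
    also have "\<dots> = exp (ln (C' * KP / K0) + Q)"
      using C' KP K0(1) by (simp add: exp_add)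
    finally have "?w0 \<le> ln (C' * KP / K0) + Q" by simp
    also have "Q = (\<Sum>j=1..m. recip (p j) * box_weight (dim (V j)) CARD('n) (dim (orth_proj (V j) ` U)) (dim W) \<alpha> \<beta> \<gamma> \<delta>
       + recip (p (j + m)) *
         box_weight CARD('n) (dim (V (j + m))) (dim U) (dim (orth_proj (V (j + m)) ` W)) \<alpha> \<beta> \<gamma> \<delta>)"
      unfolding Q_def by (intro sum.cong) (auto simp: w_def S_def T_def k_def l_def)
    finally show "?w0 \<le> ln (C' * KP / K0) + \<dots>" .
  qed
qed

lemma le_of_scaled_le:
  fixes x y \<kappa> :: real
  assumes "\<And>r. r > 0 \<Longrightarrow> r * x \<le> \<kappa> + r * y"
  shows "x \<le> y"
proof (rule ccontr)
  assume "\<not> x \<le> y"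
  then have "x - y > 0" by simp
  define r where "r = (\<bar>\<kappa>\<bar> + 1) / (x - y)"
  have "r > 0" "r * (x - y) = \<bar>\<kappa>\<bar> + 1" using \<open>x - y > 0\<close> by (auto simp: r_def)
  moreover have "r * (x - y) \<le> \<kappa>" using assms[OF \<open>r > 0\<close>] by (simp add: right_diff_distrib)
  ultimately show False by linarith
qed

text \<open>Both sides are positively homogeneous of degree one in the exponents, whereas \<kappa>
  is fixed. Multiplying the exponents by r and letting r grow removes it.\<close>

lemma heis_scaling_inequality:
  fixes m :: nat and V :: "nat \<Rightarrow> (real ^ 'n) set" and p :: "nat \<Rightarrow> ennreal"
  assumes V: "\<And>j. j \<in> {1..2*m} \<Longrightarrow> subspace (V j)"
    and p: "\<And>j. j \<in> {1..2*m} \<Longrightarrow> 0 < p j"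
    and C: "C < \<infinity>" "\<And>f :: nat \<Rightarrow> 'n heis \<Rightarrow> real.
        (\<And>j. j \<in> {1..2*m} \<Longrightarrow> nonneg_Cc_on (heis_codomain m V j) (f j)) \<Longrightarrow>
        heis_form m V f \<le> C * (\<Prod>j=1..m. Lp_norm (p j) (heis_measure m V j) (f j) *
                               Lp_norm (p (j + m)) (heis_measure m V (j + m)) (f (j + m)))"
    and U: "subspace U" and W: "subspace W" and orth: "W \<subseteq> U\<^sup>\<bottom>"
    and le: "\<beta> \<le> \<alpha>" "\<delta> \<le> \<gamma>"
  shows "box_weight CARD('n) CARD('n) (dim U) (dim W) \<alpha> \<beta> \<gamma> \<delta> \<le>
    (\<Sum>j=1..m. recip (p j) * box_weight (dim (V j)) CARD('n) (dim (orth_proj (V j) ` U)) (dim W) \<alpha> \<beta> \<gamma> \<delta>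
       + recip (p (j + m)) *
         box_weight CARD('n) (dim (V (j + m))) (dim U) (dim (orth_proj (V (j + m)) ` W)) \<alpha> \<beta> \<gamma> \<delta>)"
    (is "?l \<alpha> \<beta> \<gamma> \<delta> \<le> ?r \<alpha> \<beta> \<gamma> \<delta>")
proof -
  obtain \<kappa> where \<kappa>: "\<And>\<alpha> \<beta> \<gamma> \<delta>. \<beta> \<le> \<alpha> \<Longrightarrow> \<delta> \<le> \<gamma> \<Longrightarrow> ?l \<alpha> \<beta> \<gamma> \<delta> \<le> \<kappa> + ?r \<alpha> \<beta> \<gamma> \<delta>"
    by (rule heis_form_scaling_bound[OF V p C U W orth]) (assumption | rule that, assumption)+
  show ?thesis
  proof (rule le_of_scaled_le)
    fix r :: real assume r: "r > 0"
    then have "?l (r * \<alpha>) (r * \<beta>) (r * \<gamma>) (r * \<delta>) \<le> \<kappa> + ?r (r * \<alpha>) (r * \<beta>) (r * \<gamma>) (r * \<delta>)"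
      using le by (intro \<kappa>) auto
    also have "?l (r * \<alpha>) (r * \<beta>) (r * \<gamma>) (r * \<delta>) = r * ?l \<alpha> \<beta> \<gamma> \<delta>"
      using r by (simp add: box_weight_scale)
    also have "?r (r * \<alpha>) (r * \<beta>) (r * \<gamma>) (r * \<delta>) = r * ?r \<alpha> \<beta> \<gamma> \<delta>"
      unfolding box_weight_scale[OF less_imp_le[OF r]] sum_distrib_left
      by (intro sum.cong) (simp_all add: distrib_left mult_ac)
    finally show "r * ?l \<alpha> \<beta> \<gamma> \<delta> \<le> \<kappa> + r * ?r \<alpha> \<beta> \<gamma> \<delta>" .
  qed
qed

section \<open>Dimensions of complements and reciprocals of exponents\<close>

lemma sum_le_member_of_nonpos:
  fixes f :: "'a \<Rightarrow> real"
  assumes "finite A" "i \<in> A" "\<And>x. x \<in> A \<Longrightarrow> f x \<le> 0"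
  shows "sum f A \<le> f i"
  using member_le_sum[of i A "\<lambda>x. - f x"] assms by (simp add: sum_negf)

lemma dim_orthogonal_comp_within:
  fixes A :: "(real ^ 'n) set"
  assumes "subspace A" "subspace B" "A \<subseteq> B"
  shows "real (dim (B \<inter> A\<^sup>\<bottom>)) = real (dim B) - real (dim A)"
proof -
  have "B \<inter> A\<^sup>\<bottom> = {y \<in> B. \<forall>x\<in>A. orthogonal x y}" by (auto simp: orthogonal_comp_def)
  then show ?thesis using dim_subspace_orthogonal_to_vectors[OF assms] by simp
qed

lemma dim_orthogonal_comp:
  fixes A :: "(real ^ 'n) set"
  assumes "subspace A"
  shows "real (dim (A\<^sup>\<bottom>)) = real CARD('n) - real (dim A)"
  using dim_orthogonal_comp_within[OF assms subspace_UNIV] by simp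

lemma orth_proj_zero_image:
  assumes "subspace S"
  shows "orth_proj S ` {0} = {0}" "orth_proj S ` (S\<^sup>\<bottom>) = {0}"
proof -
  have *: "orth_proj S x = 0" if "x \<in> S\<^sup>\<bottom>" for x
    by (rule orth_proj_eqI[OF assms])
       (use that assms in \<open>auto simp: subspace_0 orthogonal_comp_def orthogonal_def\<close>)
  have "0 \<in> S\<^sup>\<bottom>" by (simp add: subspace_0 subspace_orthogonal_comp)
  with * show "orth_proj S ` {0} = {0}" "orth_proj S ` (S\<^sup>\<bottom>) = {0}" by auto
qed

lemma recip_nonneg: "0 \<le> recip q"
  by (simp add: recip_def)

lemma ge_1_of_recip_le_1:
  assumes "0 < q" "recip q \<le> 1"
  shows "1 \<le> q"
proof (cases q)
  case (real r)
  then have "r > 0" using assms(1) by simp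
  then have "recip q = 1 / r"
    using real by (simp add: recip_def divide_ennreal_def inverse_ennreal divide_inverse)
  with assms(2) have "1 / r \<le> 1" by simp
  with \<open>r > 0\<close> have "ennreal 1 \<le> ennreal r" by (intro ennreal_leI) simp
  with real show ?thesis by simp
qed simp

section \<open>Deduction of the conditions on exponents and dimensions\<close>

theorem theorem1p1:
  fixes m :: nat
    and V :: "nat \<Rightarrow> (real ^ 'n) set"
    and p :: "nat \<Rightarrow> ennreal"
  assumes "m \<ge> 1"
    and "\<And>j. j \<in> {1..2*m} \<Longrightarrow> subspace (V j)"
    and "\<And>j. j \<in> {1..m} \<Longrightarrow> V (j + m) = V j"
    and "\<And>j. j \<in> {1..2*m} \<Longrightarrow> 0 < p j"
    and "\<exists>C::ennreal. C < \<infinity> \<and>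
           (\<forall>f :: nat \<Rightarrow> 'n heis \<Rightarrow> real.
              (\<forall>j\<in>{1..2*m}. nonneg_Cc_on (heis_codomain m V j) (f j)) \<longrightarrow>
              heis_form m V f \<le>
                C * (\<Prod>j=1..m. Lp_norm (p j) (heis_measure m V j) (f j) *
                               Lp_norm (p (j + m)) (heis_measure m V (j + m)) (f (j + m))))"
  shows "(\<forall>j\<in>{1..2*m}. 1 \<le> p j) \<and>
    (\<forall>U W :: (real ^ 'n) set. subspace U \<and> subspace W \<and> W \<subseteq> U\<^sup>\<bottom> \<longrightarrow>
       (let n = real CARD('n);
            d = (\<lambda>S :: (real ^ 'n) set. real (dim S));
            L = (\<lambda>j. orth_proj (V j));
            r = (\<lambda>j. recip (p j))
        in
          n + 1 = (\<Sum>j=1..m. ((d (V j) + 1) * r j + (n + 1) * r (j + m))) \<and>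
          n + 1 = (\<Sum>j=1..m. ((n + 1) * r j + (d (V j) + 1) * r (j + m))) \<and>
          d U + 1 \<le> (\<Sum>j=1..m. ((d (L j ` U) + 1) * r j + (d U + 1) * r (j + m))) \<and>
          d U + 1 \<le> (\<Sum>j=1..m. ((d U + 1) * r j + (d (L j ` U) + 1) * r (j + m))) \<and>
          d (W\<^sup>\<bottom>) - d U \<ge>
            (\<Sum>j=1..m. (d (W\<^sup>\<bottom>) - d (L j ` U)) * r j
                      + (d (V j \<inter> (L j ` W)\<^sup>\<bottom>) - d U) * r (j + m)) \<and>
          d (W\<^sup>\<bottom>) - d U \<ge>
            (\<Sum>j=1..m. (d (V j \<inter> (L j ` W)\<^sup>\<bottom>) - d U) * r j
                      + (d (W\<^sup>\<bottom>) - d (L j ` U)) * r (j + m))))"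
proof -
  define n where "n = real CARD('n)"
  define d where "d S = real (dim S)" for S :: "(real ^ 'n) set"
  define L where "L j = orth_proj (V j)" for j
  define r where "r j = recip (p j)" for j
  have V: "subspace (V j)" if "j \<in> {1..m}" for j using assms(2) that by auto
  have r0: "r j \<ge> 0" for j by (simp add: r_def recip_nonneg)
  \<comment> \<open>The integral inequality enters only here; the rest is linear in the reciprocals
    \<open>r j\<close>, for suitable choices of subspaces and exponents.\<close>
  have ineq: "box_weight n n (d U) (d W) \<alpha> \<beta> \<gamma> \<delta> \<le>
      (\<Sum>j=1..m. r j * box_weight (d (V j)) n (d (L j ` U)) (d W) \<alpha> \<beta> \<gamma> \<delta>
        + r (j + m) * box_weight n (d (V j)) (d U) (d (L j ` W)) \<alpha> \<beta> \<gamma> \<delta>)"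
    if UW: "subspace U" "subspace W" "W \<subseteq> U\<^sup>\<bottom>" and le: "\<beta> \<le> \<alpha>" "\<delta> \<le> \<gamma>"
    for U W \<alpha> \<beta> \<gamma> \<delta>
  proof -
    obtain C where C: "C < \<infinity>"
      and bound: "\<forall>f :: nat \<Rightarrow> 'n heis \<Rightarrow> real.
        (\<forall>j\<in>{1..2*m}. nonneg_Cc_on (heis_codomain m V j) (f j)) \<longrightarrow>
        heis_form m V f \<le> C * (\<Prod>j=1..m. Lp_norm (p j) (heis_measure m V j) (f j) *
                               Lp_norm (p (j + m)) (heis_measure m V (j + m)) (f (j + m)))"
      using assms(5) by (elim exE conjE)
    note bound = bound[rule_format]
    have "box_weight n n (d U) (d W) \<alpha> \<beta> \<gamma> \<delta> \<le>
      (\<Sum>j=1..m. r j * box_weight (d (V j)) n (d (L j ` U)) (d W) \<alpha> \<beta> \<gamma> \<delta>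
        + r (j + m) * box_weight n (d (V (j + m))) (d U) (d (L (j + m) ` W)) \<alpha> \<beta> \<gamma> \<delta>)"
      unfolding n_def d_def L_def r_def
      by (rule heis_scaling_inequality[OF assms(2,4) C bound UW le])
    also have "\<dots> = (\<Sum>j=1..m. r j * box_weight (d (V j)) n (d (L j ` U)) (d W) \<alpha> \<beta> \<gamma> \<delta>
        + r (j + m) * box_weight n (d (V j)) (d U) (d (L j ` W)) \<alpha> \<beta> \<gamma> \<delta>)"
      using assms(3) by (intro sum.cong) (auto simp: L_def)
    finally show ?thesis .
  qed
  have d0: "d {0} = 0" "d (L j ` {0}) = 0" "d (L j ` ((V j)\<^sup>\<bottom>)) = 0" if "j \<in> {1..m}" for j
    using orth_proj_zero_image[OF V[OF that]] by (simp_all add: d_def L_def)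
  have d00: "d {0} = 0" by (simp add: d_def)
  have zp: "{0} \<subseteq> S\<^sup>\<bottom>" for S :: "(real ^ 'n) set"
    using subspace_0[OF subspace_orthogonal_comp[of S]] by simp
  have dperp: "d (S\<^sup>\<bottom>) = n - d S" if "subspace S" for S
    using dim_orthogonal_comp[OF that] by (simp add: d_def n_def)
  have dpos: "0 \<le> d S" for S by (simp add: d_def)
  have dn: "d S \<le> n" for S
    using dim_subset_UNIV[of S] by (simp add: d_def n_def)
  have LV: "subspace (L j ` S)" "L j ` S \<subseteq> V j" if "j \<in> {1..m}" "subspace S" for j S
    using linear_subspace_image[OF linear_orth_proj[OF V] that(2)] orth_proj_works(1)[OF V] that
    by (auto simp: L_def)
  have dLV: "d (L j ` S) \<le> d (V j)" if "j \<in> {1..m}" "subspace S" for j S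
    using dim_subset[OF LV(2)[OF that]] by (simp add: d_def)

  \<comment> \<open>With \<open>\<alpha> = \<beta>\<close> and
    \<open>\<gamma> = \<delta> = 0\<close> both arguments of the maximum in
    \<open>box_weight\<close> equal \<alpha>, so all weights are odd in \<alpha>. The two signs
    therefore give opposite inequalities.\<close>
  have A1: "n + 1 = (\<Sum>j=1..m. ((d (V j) + 1) * r j + (n + 1) * r (j + m)))"
  proof (rule antisym)
    have "n + 1 \<le> (\<Sum>j=1..m. r j * box_weight (d (V j)) n (d (L j ` {0})) (d {0}) 1 1 0 0
        + r (j + m) * box_weight n (d (V j)) (d {0}) (d (L j ` {0})) 1 1 0 0)"
      using ineq[of "{0}" "{0}" 1 1 0 0] d00 by (simp add: box_weight_def)
    also have "\<dots> = (\<Sum>j=1..m. ((d (V j) + 1) * r j + (n + 1) * r (j + m)))"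
      by (intro sum.cong) (auto simp: d0 d00 box_weight_def)
    finally show "n + 1 \<le> (\<Sum>j=1..m. ((d (V j) + 1) * r j + (n + 1) * r (j + m)))" .
    have "- (n + 1) \<le> (\<Sum>j=1..m. r j * box_weight (d (V j)) n (d (L j ` {0})) (d {0}) (-1) (-1) 0 0
        + r (j + m) * box_weight n (d (V j)) (d {0}) (d (L j ` {0})) (-1) (-1) 0 0)"
      using ineq[of "{0}" "{0}" "-1" "-1" 0 0] d00 by (simp add: box_weight_def)
    also have "\<dots> = (\<Sum>j=1..m. - ((d (V j) + 1) * r j + (n + 1) * r (j + m)))"
      by (intro sum.cong) (auto simp: d0 d00 box_weight_def algebra_simps)
    finally show "(\<Sum>j=1..m. ((d (V j) + 1) * r j + (n + 1) * r (j + m))) \<le> n + 1"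
      by (simp only: sum_negf neg_le_iff_le)
  qed
  have A2: "n + 1 = (\<Sum>j=1..m. ((n + 1) * r j + (d (V j) + 1) * r (j + m)))"
  proof (rule antisym)
    have "n + 1 \<le> (\<Sum>j=1..m. r j * box_weight (d (V j)) n (d (L j ` {0})) (d {0}) 0 0 1 1
        + r (j + m) * box_weight n (d (V j)) (d {0}) (d (L j ` {0})) 0 0 1 1)"
      using ineq[of "{0}" "{0}" 0 0 1 1] d00 by (simp add: box_weight_def)
    also have "\<dots> = (\<Sum>j=1..m. ((n + 1) * r j + (d (V j) + 1) * r (j + m)))"
      by (intro sum.cong) (auto simp: d0 d00 box_weight_def)
    finally show "n + 1 \<le> (\<Sum>j=1..m. ((n + 1) * r j + (d (V j) + 1) * r (j + m)))" .
    have "- (n + 1) \<le> (\<Sum>j=1..m. r j * box_weight (d (V j)) n (d (L j ` {0})) (d {0}) 0 0 (-1) (-1)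
        + r (j + m) * box_weight n (d (V j)) (d {0}) (d (L j ` {0})) 0 0 (-1) (-1))"
      using ineq[of "{0}" "{0}" 0 0 "-1" "-1"] d00 by (simp add: box_weight_def)
    also have "\<dots> = (\<Sum>j=1..m. - ((n + 1) * r j + (d (V j) + 1) * r (j + m)))"
      by (intro sum.cong) (auto simp: d0 d00 box_weight_def algebra_simps)
    finally show "(\<Sum>j=1..m. ((n + 1) * r j + (d (V j) + 1) * r (j + m))) \<le> n + 1"
      by (simp only: sum_negf neg_le_iff_le)
  qed
  \<comment> \<open>The instances are \<open>\<beta> = 0\<close>, \<open>\<alpha> = 1\<close>,
    \<open>\<delta> = 0\<close>, \<open>\<gamma> = 1\<close>: the maximum is 1, and each weight is
    the sum of its two core dimensions plus 1.\<close>
  have star: "d U + d W + 1 \<le> (\<Sum>j=1..m. (d (L j ` U) + d W + 1) * r j + (d U + d (L j ` W) + 1) * r (j + m))"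
    if "subspace U" "subspace W" "W \<subseteq> U\<^sup>\<bottom>" for U W
    using ineq[OF that, of 0 1 0 1] by (simp add: box_weight_def mult.commute)
  have ge1: "1 \<le> p j" if j: "j \<in> {1..2*m}" for j
  proof (rule ge_1_of_recip_le_1)
    show "0 < p j" by (rule assms(4)[OF j])
    show "recip (p j) \<le> 1"
    proof (cases "j \<le> m")
      case True
      then have jm: "j \<in> {1..m}" using j by auto
      \<comment> \<open>As \<open>L j\<close> maps \<open>?U\<close> to 0, the weight on the left
        and the weight at \<open>r j\<close> are both \<open>- (d (V j) + n + 1)\<close>. All other
        weights are nonpositive; dropping them leaves \<open>r j \<le> 1\<close>.\<close>
      let ?U = "(V j)\<^sup>\<bottom>"
      let ?t = "\<lambda>i. r i * box_weight (d (V i)) n (d (L i ` ?U)) (d {0}) 0 (-1) (-1) (-1)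
        + r (i + m) * box_weight n (d (V i)) (d ?U) (d (L i ` {0})) 0 (-1) (-1) (-1)"
      have sU: "subspace ?U" by (rule subspace_orthogonal_comp)
      have "- (d (V j) + n + 1) \<le> (\<Sum>i=1..m. ?t i)"
        using ineq[OF sU subspace_single_0 zp, of "-1" 0 "-1" "-1"]
          dperp[OF V[OF jm]] d00 by (simp add: box_weight_def)
      also have "\<dots> \<le> ?t j"
      proof (rule sum_le_member_of_nonpos)
        fix i assume i: "i \<in> {1..m}"
        show "?t i \<le> 0"
          using dLV[OF i sU] dn[of ?U] dn[of "{0}"] d0[OF i] dn[of "V i"]
          by (intro add_nonpos_nonpos mult_nonneg_nonpos r0) (auto simp: box_weight_def d_def)
      qed (use jm in auto)
      also have "\<dots> \<le> - r j * (d (V j) + n + 1)"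
      proof -
        have "0 \<le> r (j + m) * (n - d ?U + d (V j) + 1)"
          using dn[of ?U] dpos[of "V j"] by (intro mult_nonneg_nonneg r0) auto
        then show ?thesis
          by (simp add: box_weight_def d0(2,3)[OF jm] d00 algebra_simps del: image_insert)
      qed
      finally have "r j * (d (V j) + n + 1) \<le> 1 * (d (V j) + n + 1)" by simp
      moreover have "d (V j) + n + 1 > 0" by (simp add: d_def n_def add_nonneg_pos)
      ultimately show ?thesis by (simp add: r_def)
    next
      case False
      define j' where "j' = j - m"
      have jm: "j' \<in> {1..m}" and jj: "j = j' + m" using False j by (auto simp: j'_def)
      \<comment> \<open>The mirror case: x and y exchange roles, and \<open>W = ?W\<close> is the
        complement that \<open>L j'\<close> annihilates.\<close>
      let ?W = "(V j')\<^sup>\<bottom>"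
      let ?t = "\<lambda>i. r i * box_weight (d (V i)) n (d (L i ` {0})) (d ?W) (-1) (-1) 0 (-1)
        + r (i + m) * box_weight n (d (V i)) (d {0}) (d (L i ` ?W)) (-1) (-1) 0 (-1)"
      have sW: "subspace ?W" by (rule subspace_orthogonal_comp)
      have "- (d (V j') + n + 1) \<le> (\<Sum>i=1..m. ?t i)"
        using ineq[OF subspace_single_0 sW, of "-1" "-1" "-1" 0]
          dperp[OF V[OF jm]] d00 by (simp add: box_weight_def)
      also have "\<dots> \<le> ?t j'"
      proof (rule sum_le_member_of_nonpos)
        fix i assume i: "i \<in> {1..m}"
        show "?t i \<le> 0"
          using dLV[OF i sW] dn[of ?W] dn[of "{0}"] d0[OF i] dn[of "V i"]
          by (intro add_nonpos_nonpos mult_nonneg_nonpos r0) (auto simp: box_weight_def d_def)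
      qed (use jm in auto)
      also have "\<dots> \<le> - r j * (d (V j') + n + 1)"
      proof -
        have "0 \<le> r j' * (n - d ?W + d (V j') + 1)"
          using dn[of ?W] dpos[of "V j'"] by (intro mult_nonneg_nonneg r0) auto
        then show ?thesis
          by (simp add: box_weight_def d0(2,3)[OF jm] d00 jj algebra_simps del: image_insert)
      qed
      finally have "r j * (d (V j') + n + 1) \<le> 1 * (d (V j') + n + 1)" by simp
      moreover have "d (V j') + n + 1 > 0" by (simp add: d_def n_def add_nonneg_pos)
      ultimately show ?thesis by (simp add: r_def)
    qed
  qed
  have main: "d U + 1 \<le> (\<Sum>j=1..m. ((d (L j ` U) + 1) * r j + (d U + 1) * r (j + m)))"
    "d U + 1 \<le> (\<Sum>j=1..m. ((d U + 1) * r j + (d (L j ` U) + 1) * r (j + m)))"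
    "(\<Sum>j=1..m. (d (W\<^sup>\<bottom>) - d (L j ` U)) * r j + (d (V j \<inter> (L j ` W)\<^sup>\<bottom>) - d U) * r (j + m))
      \<le> d (W\<^sup>\<bottom>) - d U"
    "(\<Sum>j=1..m. (d (V j \<inter> (L j ` W)\<^sup>\<bottom>) - d U) * r j + (d (W\<^sup>\<bottom>) - d (L j ` U)) * r (j + m))
      \<le> d (W\<^sup>\<bottom>) - d U"
    if U: "subspace U" and W: "subspace W" and orth: "W \<subseteq> U\<^sup>\<bottom>" for U W
  proof -
    \<comment> \<open>(B1) is \<open>star\<close> with zero second subspace; (B2) below has zero in
      the first place and U in the second.\<close>
    from star[OF U subspace_single_0 zp]
    have "d U + 1 \<le> (\<Sum>j=1..m. (d (L j ` U) + d {0} + 1) * r j + (d U + d (L j ` {0}) + 1) * r (j + m))"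
      by (simp add: d00)
    also have "\<dots> = (\<Sum>j=1..m. ((d (L j ` U) + 1) * r j + (d U + 1) * r (j + m)))"
      by (intro sum.cong) (auto simp: d0 d00 simp del: image_insert)
    finally show "d U + 1 \<le> (\<Sum>j=1..m. ((d (L j ` U) + 1) * r j + (d U + 1) * r (j + m)))" .
    have "U \<subseteq> {0}\<^sup>\<bottom>" by simp
    from star[OF subspace_single_0 U this]
    have "d U + 1 \<le> (\<Sum>j=1..m. (d (L j ` {0}) + d U + 1) * r j + (d {0} + d (L j ` U) + 1) * r (j + m))"
      by (simp add: d00)
    also have "\<dots> = (\<Sum>j=1..m. ((d U + 1) * r j + (d (L j ` U) + 1) * r (j + m)))"
      by (intro sum.cong) (auto simp: d0 d00 simp del: image_insert)
    finally show "d U + 1 \<le> (\<Sum>j=1..m. ((d U + 1) * r j + (d (L j ` U) + 1) * r (j + m)))" .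
    have perp: "d (V j \<inter> (L j ` W)\<^sup>\<bottom>) = d (V j) - d (L j ` W)" if "j \<in> {1..m}" for j
      using dim_orthogonal_comp_within[OF LV(1)[OF that W] V[OF that] LV(2)[OF that W]]
      by (simp add: d_def)
    \<comment> \<open>Termwise, the sum in (C1) is the second equality of (A) minus
      \<open>star\<close>; on the other side, (n + 1) - (d U + d W + 1) is the dimension of
      \<open>W\<^sup>\<bottom>\<close> minus that of U.\<close>
    have "(\<Sum>j=1..m. (d (W\<^sup>\<bottom>) - d (L j ` U)) * r j + (d (V j \<inter> (L j ` W)\<^sup>\<bottom>) - d U) * r (j + m))
      = (\<Sum>j=1..m. ((n + 1) * r j + (d (V j) + 1) * r (j + m))
        - ((d (L j ` U) + d W + 1) * r j + (d U + d (L j ` W) + 1) * r (j + m)))"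
      by (intro sum.cong) (auto simp: perp dperp[OF W] algebra_simps)
    then show "(\<Sum>j=1..m. (d (W\<^sup>\<bottom>) - d (L j ` U)) * r j + (d (V j \<inter> (L j ` W)\<^sup>\<bottom>) - d U) * r (j + m))
      \<le> d (W\<^sup>\<bottom>) - d U"
      using A2 star[OF U W orth] by (simp only: sum_subtractf dperp[OF W])
    \<comment> \<open>Orthogonality is symmetric, so \<open>star\<close> also holds with U and W
      exchanged. Subtracting that from the first equality of (A) yields (C2).\<close>
    have "U \<subseteq> W\<^sup>\<bottom>"
      using orthogonal_comp_anti_mono[OF orth] orthogonal_comp_subset[of U] by blast
    then have star': "d W + d U + 1 \<le> (\<Sum>j=1..m. (d (L j ` W) + d U + 1) * r j + (d W + d (L j ` U) + 1) * r (j + m))"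
      by (rule star[OF W U])
    have "(\<Sum>j=1..m. (d (V j \<inter> (L j ` W)\<^sup>\<bottom>) - d U) * r j + (d (W\<^sup>\<bottom>) - d (L j ` U)) * r (j + m))
      = (\<Sum>j=1..m. ((d (V j) + 1) * r j + (n + 1) * r (j + m))
        - ((d (L j ` W) + d U + 1) * r j + (d W + d (L j ` U) + 1) * r (j + m)))"
      by (intro sum.cong) (auto simp: perp dperp[OF W] algebra_simps)
    then show "(\<Sum>j=1..m. (d (V j \<inter> (L j ` W)\<^sup>\<bottom>) - d U) * r j + (d (W\<^sup>\<bottom>) - d (L j ` U)) * r (j + m))
      \<le> d (W\<^sup>\<bottom>) - d U"
      using A1 star' by (simp only: sum_subtractf dperp[OF W])
  qed
  show ?thesis
    unfolding Let_def
  proof (intro conjI ballI allI impI; (elim conjE)?)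
    show "1 \<le> p j" if "j \<in> {1..2*m}" for j by (rule ge1[OF that])
  qed (rule A1[unfolded n_def d_def r_def] A2[unfolded n_def d_def r_def]
      main[unfolded d_def L_def r_def]; assumption)+
qed

end
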